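(* Let $\kappa>\mathfrak{c}$ be a regular cardinal such that $\mu^{\aleph_0}<\kappa$ for every cardinal $\mu<\kappa$, and let $X_{\kappa^+}$ be the metric space constructed in the context. Then $X_{\kappa^+}$ is a rigid $\kappa$-superuniversal metric space.
   Context: A metric space $X$ is $\kappa$-superuniversal if for every metric space $Y$ with $|Y|\leq\kappa$, every isometric embedding into $X$ of a subset of $Y$ of cardinality less than $\kappa$ extends to an isometric embedding of $Y$ into $X$. A metric space is rigid if its only isometry onto itself (distance-preserving bijection) is the identity. Conventions. $\mathfrak{c}=2^{\aleph_0}$; $[X]^{\mu}$, $[X]^{<\mu}$ are the families of subsets of $X$ of cardinality $\mu$, less than $\mu$. A metric space is discrete if all its distances lie in $\{0,1\}$. For a discrete subspace $D$ of a metric space $(X,d)$: a middle point of $D$ in $X$ is $x\in X$ with $d(x,y)=1/2$ for all $y\in D$; $D$ is hereditarily without middle points in $X$ if no $Z\in[D]^{\kappa}$ has a middle point in $X$. Amalgam. Let $X$ be a nonempty metric space and $\{(X_s,d_s)\}_s$ metric spaces such that $X\cap X_s\neq\emptyset$, $d_s$ agrees with the metric of $X$ on $X\cap X_s$, and $X_s\cap X_t\subseteq X$ for $s\neq t$. On $P=X\cup\bigcup_s X_s$ let $\rho(x,y)$ be the infimum of $\sum_{i<n}\rho_i(z_i,z_{i+1})$ over finite sequences $x=z_0,\ldots,z_n=y$ in which each pair $z_i,z_{i+1}$ lies in a common member of the family (one of $X$, $X_s$), $\rho_i$ being the metric of that member. Then $\rho$ is a pseudometric on $P$ restricting to the given metrics.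 The amalgam is the metric space $(Y,\rho)$, where $Y\subseteq P$ contains $X$ and has exactly one point in each class of the relation $\rho(x,y)=0$; it contains $X$ as a subspace, and if the distances from points of $X_s\setminus X$ to points of $X_s\cap X$ (all $s$) are bounded below by some $\delta>0$, then $Y=P$. Operation $F$. For a nonempty metric space $(X,d)$ let $\lambda=(|X|+\mathfrak{c})^{<\kappa}$, enumerate (with repetitions allowed) $[X]^{<\kappa}\setminus\{\emptyset\}=\{X_\alpha:\alpha<\lambda\}$, take pairwise distinct points $a_{\alpha,\beta}\notin X$ ($\alpha,\beta<\lambda$) and metrics $d_{\alpha,\beta}$ on $X_\alpha\cup\{a_{\alpha,\beta}\}$ extending $d$ on $X_\alpha$, such that for every $\alpha$, every metric space $Y$, $y\in Y$ and isometry $f_0$ of $Y\setminus\{y\}$ onto $X_\alpha$, there are $\beta<\lambda$ and an isometry $f$ of $Y$ onto $X_\alpha\cup\{a_{\alpha,\beta}\}$ extending $f_0$. $F(X)$ is the amalgam of $X$ and all the spaces $X_\alpha\cup\{a_{\alpha,\beta}\}$. Operation $A$. For a metric space $X$ and $Y\subseteq X$ enumerate injectively $X\setminus Y=\{x_\alpha:\alpha<\lambda\}$, $\lambda$ a cardinal, and take pairwise disjoint sets $D_\alpha$, disjoint from $X$, with $|D_\alpha|=\aleph_{\kappa+|X|+\alpha+2}$ (ordinal sum in the index). $A(X,Y)$ is the amalgam of $X$ and the discrete spaces $D_\alpha\cup\{x_\alpha\}$; its underlying set is $X\cup\bigcup_\alpha D_\alpha$. Put $\mathcal{A}(X,Y)=\{D_\alpha\cup\{x_\alpha\}:\alpha<\lambda\}$.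 Operation $S$. For a metric space $X$ and a family $\mathcal{G}$ of subsets of $X$, let $\mathcal{D}(X)$ be the set of all discrete $Y\in[X]^\kappa$ that are hereditarily without middle points in $X$, and let $\{Y_\alpha:\alpha<\lambda\}$ enumerate $\{Y\in\mathcal{D}(X): |Y\cap Z|<\kappa\text{ for all }Z\in\mathcal{G}\}$. Take pairwise distinct points $z_\alpha\notin X$ and make $Y_\alpha\cup\{z_\alpha\}$ a metric space extending $Y_\alpha$ by giving $z_\alpha$ distance $1/2$ to every point of $Y_\alpha$. $S(X,\mathcal{G})$ is the amalgam of $X$ and the spaces $Y_\alpha\cup\{z_\alpha\}$; its underlying set is $X\cup\{z_\alpha:\alpha<\lambda\}$. Construction of $X_{\kappa^+}$. $X_0=\emptyset$, $X_1=\{0\}$. If $\alpha$ is a nonzero limit ordinal, $X_{\alpha+1}=X_\alpha=\bigcup_{\beta<\alpha}X_\beta$ and $\mathcal{A}(X_{\alpha+1},X_\alpha)=\emptyset$. If $\alpha=\beta+2$, then $X_\alpha=F\bigl(S\bigl(A(X_{\beta+1},X_\beta),\bigcup_{\gamma\leq\beta}\mathcal{A}(X_{\gamma+1},X_\gamma)\bigr)\bigr)$. Each $X_\beta$ is a subspace of $X_\alpha$ for $\beta<\alpha$, and $X_{\kappa^+}=\bigcup_{\alpha<\kappa^+}X_\alpha$ with the common extension metric. The choices made (enumerations, new points, transversals) are arbitrary. *)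

theory Defs
  imports "HOL-Analysis.Analysis"
begin

unbundle cardinal_syntax

section \<open>Cardinals and ordinals\<close>

text \<open>
  Ordinals are well-orders (up to order isomorphism) and cardinals are the well-orders \<open>r\<close> with
  \<^term>\<open>Card_order r\<close>.  A cardinal below \<open>\<kappa> :: 'k rel\<close> is isomorphic to one on the type \<open>'k\<close>, so
  quantifying over cardinals below \<open>\<kappa>\<close> on that type loses nothing.
\<close>

abbreviation continuum :: "(nat \<Rightarrow> bool) rel" where
  "continuum \<equiv> ctwo ^c natLeq"

text \<open>\<open>l\<close> is \<open>m\<^sup><\<^sup>\<kappa>\<close>, the supremum of the cardinals \<open>m\<^sup>\<nu>\<close> over the cardinals \<open>\<nu> < \<kappa>\<close>.\<close>

definition is_weak_power :: "'m rel \<Rightarrow> 'k rel \<Rightarrow> 'l rel \<Rightarrow> bool" where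
  "is_weak_power m \<kappa> l \<longleftrightarrow>
     Card_order l \<and>
     (\<forall>\<nu> :: 'k rel. Card_order \<nu> \<and> \<nu> <o \<kappa> \<longrightarrow> m ^c \<nu> \<le>o l) \<and>
     (\<forall>l' :: 'l rel. Card_order l' \<and>
        (\<forall>\<nu> :: 'k rel. Card_order \<nu> \<and> \<nu> <o \<kappa> \<longrightarrow> m ^c \<nu> \<le>o l') \<longrightarrow> l \<le>o l')"

definition ord_sum :: "'a rel \<Rightarrow> 'b rel \<Rightarrow> ('a + 'b) rel" where
  "ord_sum r s = map_prod Inl Inl ` r \<union> map_prod Inr Inr ` s \<union>
     {(Inl a, Inr b) | a b. a \<in> Field r \<and> b \<in> Field s}"

definition ord_zero :: "'o rel \<Rightarrow> 'o" where
  "ord_zero r = wo_rel.minim r (Field r)"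

definition ord_succ :: "'o rel \<Rightarrow> 'o \<Rightarrow> 'o" where
  "ord_succ r i = wo_rel.suc r {i}"

definition ord_limit :: "'o rel \<Rightarrow> 'o \<Rightarrow> bool" where
  "ord_limit r i \<longleftrightarrow> i \<in> Field r \<and> i \<noteq> ord_zero r \<and> (\<forall>j\<in>Field r. i \<noteq> ord_succ r j)"

text \<open>The initial segment below \<open>i\<close>, i.e. the ordinal represented by \<open>i \<in> Field r\<close>.\<close>

abbreviation ord_below :: "'o rel \<Rightarrow> 'o \<Rightarrow> 'o rel" where
  "ord_below r i \<equiv> Restr r (underS r i)"

text \<open>
  \<open>|D| = \<aleph>\<^sub>r\<close> for the ordinal \<open>r\<close>: the aleph hierarchy is \<open>\<aleph>\<^sub>i = \<close> least infinite cardinal above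
  all \<open>\<aleph>\<^sub>j\<close>, \<open>j < i\<close>.  The function \<open>h\<close> lists sets of the cardinalities below \<open>\<aleph>\<^sub>r\<close>; every
  cardinal up to \<open>|D|\<close> is the cardinality of a set over the type of the elements of \<open>D\<close>.
\<close>

definition least_infinite_above :: "'a set set \<Rightarrow> 'a set \<Rightarrow> bool" where
  "least_infinite_above \<C> D \<longleftrightarrow>
     infinite D \<and> (\<forall>C\<in>\<C>. |C| <o |D| ) \<and>
     (\<forall>E :: 'a set. infinite E \<and> (\<forall>C\<in>\<C>. |C| <o |E| ) \<longrightarrow> |D| \<le>o |E| )"

definition has_card_aleph :: "'o rel \<Rightarrow> 'a set \<Rightarrow> bool" where
  "has_card_aleph r D \<longleftrightarrow>
     (\<exists>h :: 'o \<Rightarrow> 'a set.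
        (\<forall>i\<in>Field r. least_infinite_above (h ` underS r i) (h i)) \<and>
        least_infinite_above (h ` Field r) D)"


section \<open>Metric spaces\<close>

definition isometric_embedding :: "'a metric \<Rightarrow> 'b metric \<Rightarrow> ('a \<Rightarrow> 'b) \<Rightarrow> bool" where
  "isometric_embedding M N f \<longleftrightarrow>
     f \<in> mspace M \<rightarrow> mspace N \<and>
     (\<forall>x\<in>mspace M. \<forall>y\<in>mspace M. mdist N (f x) (f y) = mdist M x y)"

definition isometry_onto :: "'a metric \<Rightarrow> 'b metric \<Rightarrow> ('a \<Rightarrow> 'b) \<Rightarrow> bool" where
  "isometry_onto M N f \<longleftrightarrow> isometric_embedding M N f \<and> f ` mspace M = mspace N"

definition rigid :: "'a metric \<Rightarrow> bool" where
  "rigid X \<longleftrightarrow> (\<forall>f. isometry_onto X X f \<longrightarrow> (\<forall>x\<in>mspace X. f x = x))"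

text \<open>
  The test spaces \<open>Y\<close> have their points in the type \<open>'b\<close>; with \<open>'b\<close> a free type variable of a
  theorem, they range over all metric spaces.
\<close>

definition superuniversal :: "'b itself \<Rightarrow> 'k rel \<Rightarrow> 'a metric \<Rightarrow> bool" where
  "superuniversal (T :: 'b itself) \<kappa> X \<longleftrightarrow>
     (\<forall>(Y :: 'b metric) Z f.
        |mspace Y| \<le>o \<kappa> \<and> Z \<subseteq> mspace Y \<and> |Z| <o \<kappa> \<and> isometric_embedding (submetric Y Z) X f \<longrightarrow>
        (\<exists>g. isometric_embedding Y X g \<and> (\<forall>z\<in>Z. g z = f z)))"

text \<open>
  Values of \<^const>\<open>mdist\<close> outside the underlying set are arbitrary, so spaces are compared by the
  following relations rather than by equality.
\<close>

definition agree_on :: "'a set \<Rightarrow> 'a metric \<Rightarrow> 'a metric \<Rightarrow> bool" where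
  "agree_on S M N \<longleftrightarrow> (\<forall>x\<in>S. \<forall>y\<in>S. mdist M x y = mdist N x y)"

definition is_subspace :: "'a metric \<Rightarrow> 'a metric \<Rightarrow> bool" where
  "is_subspace M N \<longleftrightarrow> mspace M \<subseteq> mspace N \<and> agree_on (mspace M) M N"

definition is_discrete :: "'a metric \<Rightarrow> bool" where
  "is_discrete M \<longleftrightarrow> (\<forall>x\<in>mspace M. \<forall>y\<in>mspace M. mdist M x y \<in> {0, 1})"

definition middle_point :: "'a metric \<Rightarrow> 'a set \<Rightarrow> 'a \<Rightarrow> bool" where
  "middle_point X D x \<longleftrightarrow> x \<in> mspace X \<and> (\<forall>y\<in>D. mdist X x y = 1/2)"

definition hereditarily_without_middle_points :: "'k rel \<Rightarrow> 'a metric \<Rightarrow> 'a set \<Rightarrow> bool" where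
  "hereditarily_without_middle_points \<kappa> X D \<longleftrightarrow>
     \<not> (\<exists>Z. Z \<subseteq> D \<and> |Z| =o \<kappa> \<and> (\<exists>x. middle_point X Z x))"


section \<open>Amalgams\<close>

definition amalgam_dist :: "'a metric set \<Rightarrow> 'a \<Rightarrow> 'a \<Rightarrow> real" where
  "amalgam_dist \<M> x y =
     Inf {(\<Sum>i<n. mdist (m i) (z i) (z (Suc i))) | (n :: nat) m z.
            z 0 = x \<and> z n = y \<and>
            (\<forall>i<n. m i \<in> \<M> \<and> z i \<in> mspace (m i) \<and> z (Suc i) \<in> mspace (m i))}"

definition amalgamable :: "'a metric \<Rightarrow> 's set \<Rightarrow> ('s \<Rightarrow> 'a metric) \<Rightarrow> bool" where
  "amalgamable X I N \<longleftrightarrow>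
     mspace X \<noteq> {} \<and>
     (\<forall>s\<in>I. mspace X \<inter> mspace (N s) \<noteq> {} \<and> agree_on (mspace X \<inter> mspace (N s)) X (N s)) \<and>
     (\<forall>s\<in>I. \<forall>t\<in>I. s \<noteq> t \<longrightarrow> mspace (N s) \<inter> mspace (N t) \<subseteq> mspace X)"

text \<open>
  The operations below are relations, since they depend on choices: here \<open>Y\<close> is an amalgam of \<open>X\<close>
  and the spaces \<open>N s\<close>, \<open>s \<in> I\<close>, for some choice of the transversal.
\<close>

definition is_amalgam :: "'a metric \<Rightarrow> 's set \<Rightarrow> ('s \<Rightarrow> 'a metric) \<Rightarrow> 'a metric \<Rightarrow> bool" where
  "is_amalgam X I N Y \<longleftrightarrow>
     amalgamable X I N \<and>
     (let P = mspace X \<union> (\<Union>s\<in>I. mspace (N s));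
          \<rho> = amalgam_dist (insert X (N ` I))
      in mspace X \<subseteq> mspace Y \<and> mspace Y \<subseteq> P \<and>
         (\<forall>p\<in>P. \<exists>!y. y \<in> mspace Y \<and> \<rho> p y = 0) \<and>
         (\<forall>x\<in>mspace Y. \<forall>y\<in>mspace Y. mdist Y x y = \<rho> x y))"


section \<open>The operations F, A and S\<close>

text \<open>
  \<open>FX\<close> is a result of the operation F applied to \<open>X\<close>.  The indices \<open>\<alpha>, \<beta> < \<lambda>\<close> are the elements of
  the field of \<open>l\<close>, which represents the cardinal \<open>\<lambda>\<close> on the type \<open>'a\<close> of points; as \<open>\<lambda>\<close> many
  distinct points \<open>a \<alpha> \<beta>\<close> are needed in \<open>'a\<close> anyway, this is no restriction.
  Likewise it suffices to let the spaces \<open>T\<close> range over metric spaces on \<open>'a\<close>: every space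
  whose points other than one form a copy of \<open>E \<alpha>\<close> is isometric to a space on \<open>E \<alpha>\<close>
  together with some point of \<open>'a\<close> outside \<open>X\<close>.
\<close>

definition is_F :: "'k rel \<Rightarrow> 'a metric \<Rightarrow> 'a metric \<Rightarrow> bool" where
  "is_F \<kappa> X FX \<longleftrightarrow>
     mspace X \<noteq> {} \<and>
     (\<exists>(l :: 'a rel) (E :: 'a \<Rightarrow> 'a set) (a :: 'a \<Rightarrow> 'a \<Rightarrow> 'a) (N :: 'a \<Rightarrow> 'a \<Rightarrow> 'a metric).
        is_weak_power ( |mspace X| +c continuum) \<kappa> l \<and>
        E ` Field l = {Z. Z \<subseteq> mspace X \<and> |Z| <o \<kappa> \<and> Z \<noteq> {}} \<and>
        inj_on (\<lambda>(\<alpha>, \<beta>). a \<alpha> \<beta>) (Field l \<times> Field l) \<and>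
        (\<forall>\<alpha>\<in>Field l. \<forall>\<beta>\<in>Field l.
           a \<alpha> \<beta> \<notin> mspace X \<and>
           mspace (N \<alpha> \<beta>) = insert (a \<alpha> \<beta>) (E \<alpha>) \<and>
           agree_on (E \<alpha>) X (N \<alpha> \<beta>)) \<and>
        (\<forall>\<alpha>\<in>Field l. \<forall>(T :: 'a metric) t f0.
           t \<in> mspace T \<and>
           isometry_onto (submetric T (mspace T - {t})) (submetric X (E \<alpha>)) f0 \<longrightarrow>
           (\<exists>\<beta>\<in>Field l. \<exists>f. isometry_onto T (N \<alpha> \<beta>) f \<and> (\<forall>x\<in>mspace T - {t}. f x = f0 x))) \<and>
        is_amalgam X (Field l \<times> Field l) (\<lambda>(\<alpha>, \<beta>). N \<alpha> \<beta>) FX)"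

text \<open>
  \<open>AX\<close> and \<open>\<A>\<close> are the space and the family of sets resulting from the operation A applied
  to \<open>X\<close> and \<open>Y \<subseteq> X\<close>.  The cardinal \<open>l = |X - Y|\<close> is a well-order of the set \<open>X - Y\<close>, which thus
  serves as the set of ordinals \<open>\<alpha> < l\<close>; the enumeration \<open>x\<close> is an arbitrary bijection.
\<close>

definition is_A :: "'k rel \<Rightarrow> 'a metric \<Rightarrow> 'a set \<Rightarrow> 'a metric \<Rightarrow> 'a set set \<Rightarrow> bool" where
  "is_A \<kappa> X Y AX \<A> \<longleftrightarrow>
     Y \<subseteq> mspace X \<and>
     (let l = |mspace X - Y|
      in \<exists>(x :: 'a \<Rightarrow> 'a) (D :: 'a \<Rightarrow> 'a set) (N :: 'a \<Rightarrow> 'a metric).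
           bij_betw x (Field l) (mspace X - Y) \<and>
           disjoint_family_on D (Field l) \<and>
           (\<forall>\<alpha>\<in>Field l.
              D \<alpha> \<inter> mspace X = {} \<and>
              has_card_aleph
                (ord_sum \<kappa> (ord_sum |mspace X| (ord_sum (ord_below l \<alpha>) (natLeq_on 2)))) (D \<alpha>) \<and>
              mspace (N \<alpha>) = insert (x \<alpha>) (D \<alpha>) \<and>
              is_discrete (N \<alpha>)) \<and>
           is_amalgam X (Field l) N AX \<and>
           \<A> = (\<lambda>\<alpha>. insert (x \<alpha>) (D \<alpha>)) ` Field l)"

definition discrete_without_middle_points :: "'k rel \<Rightarrow> 'a metric \<Rightarrow> 'a set set" where
  "discrete_without_middle_points \<kappa> X =
     {Y. Y \<subseteq> mspace X \<and> |Y| =o \<kappa> \<and> is_discrete (submetric X Y) \<and>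
         hereditarily_without_middle_points \<kappa> X Y}"

text \<open>
  \<open>SX\<close> is a result of the operation S applied to \<open>X\<close> and \<open>\<G>\<close>.  The order of the enumeration
  \<open>{Y\<^sub>\<alpha>}\<close> plays no role, so the new points are indexed by the enumerated sets themselves.
\<close>

definition is_S :: "'k rel \<Rightarrow> 'a metric \<Rightarrow> 'a set set \<Rightarrow> 'a metric \<Rightarrow> bool" where
  "is_S \<kappa> X \<G> SX \<longleftrightarrow>
     (let \<Y> = {Y \<in> discrete_without_middle_points \<kappa> X. \<forall>Z\<in>\<G>. |Y \<inter> Z| <o \<kappa>}
      in \<exists>(z :: 'a set \<Rightarrow> 'a) (N :: 'a set \<Rightarrow> 'a metric).
           inj_on z \<Y> \<and>
           (\<forall>Y\<in>\<Y>.
              z Y \<notin> mspace X \<and>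
              mspace (N Y) = insert (z Y) Y \<and>
              agree_on Y X (N Y) \<and>
              (\<forall>y\<in>Y. mdist (N Y) (z Y) y = 1/2)) \<and>
           is_amalgam X \<Y> N SX)"


section \<open>The transfinite construction\<close>

text \<open>
  \<open>X \<alpha>\<close> for \<open>\<alpha> < \<kappa>\<^sup>+\<close> are the successive spaces, \<open>\<A> \<alpha>\<close> is the family \<open>\<A>(X\<^bsub>\<alpha>+1\<^esub>, X\<^sub>\<alpha>)\<close>, and
  \<open>X\<kappa>\<close> is the union; the predicate says that they arise from the construction for some choices
  of enumerations, new points and transversals.  All points live in one type \<open>'a\<close>, which must be
  large enough for such a construction to exist.  The ordinals below \<open>\<kappa>\<^sup>+\<close> are the elements of the
  field of \<^term>\<open>cardSuc \<kappa>\<close>.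
\<close>

definition is_construction ::
  "'k rel \<Rightarrow> ('k set \<Rightarrow> 'a metric) \<Rightarrow> ('k set \<Rightarrow> 'a set set) \<Rightarrow> 'a metric \<Rightarrow> bool" where
  "is_construction \<kappa> X \<A> X\<kappa> \<longleftrightarrow>
     (let r = cardSuc \<kappa>; s = ord_succ r
      in mspace (X (ord_zero r)) = {} \<and>
         (\<exists>p. mspace (X (s (ord_zero r))) = {p}) \<and>
         (\<forall>\<alpha>. ord_limit r \<alpha> \<longrightarrow>
            mspace (X \<alpha>) = (\<Union>\<beta>\<in>underS r \<alpha>. mspace (X \<beta>)) \<and>
            (\<forall>\<beta>\<in>underS r \<alpha>. is_subspace (X \<beta>) (X \<alpha>)) \<and>
            mspace (X (s \<alpha>)) = mspace (X \<alpha>) \<and> is_subspace (X \<alpha>) (X (s \<alpha>)) \<and>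
            \<A> \<alpha> = {}) \<and>
         (\<forall>\<beta>\<in>Field r. \<exists>AX SX.
            is_A \<kappa> (X (s \<beta>)) (mspace (X \<beta>)) AX (\<A> \<beta>) \<and>
            is_S \<kappa> AX (\<Union>\<gamma>\<in>under r \<beta>. \<A> \<gamma>) SX \<and>
            is_F \<kappa> SX (X (s (s \<beta>)))) \<and>
         mspace X\<kappa> = (\<Union>\<alpha>\<in>Field r. mspace (X \<alpha>)) \<and>
         (\<forall>\<alpha>\<in>Field r. is_subspace (X \<alpha>) X\<kappa>))"

end

theory Submission
  imports Defs
begin

text \<open>
  Let \<open>d\<close> be the metric of the union \<open>X\<kappa>\<close>.  Every point \<open>x\<close> is born at a successor stage, and the operation A
  of the following stage attaches to it a set \<open>D\<^sub>x\<close> of points at distance one from each other and from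
  \<open>x\<close>.  The cardinality of \<open>D\<^sub>x\<close> exceeds \<open>\<kappa>\<close> and determines \<open>x\<close>: two sets attached at the same stage
  have different alephs by construction, and a set attached later is larger than the whole earlier
  space.  Rigidity means that an isometry can recognize \<open>D\<^sub>x\<close> by metric properties.

  In an amalgam every path from a new point into the rest passes through the core.  So the distances
  of a new point are determined by its distances to a small piece of the core: by \<open>x\<close> alone for the points
  of \<open>D\<^sub>x\<close>, by fewer than \<open>\<kappa>\<close> points for those added by F, and by the \<open>\<kappa>\<close> points of \<open>Y\<close> for the middle point of
  \<open>Y\<close> added by S.  Following these three cases through the stages yields two facts about \<open>D\<^sub>x\<close>.
  First, a point \<open>p\<close> outside \<open>D\<^sub>x \<union> {x}\<close> has distance one from at most \<open>\<kappa>\<close> points of \<open>D\<^sub>x\<close>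
  (\<open>few_close_points\<close>).  Second, \<open>D\<^sub>x\<close> is hereditarily without middle points in \<open>X\<kappa>\<close>
  (\<open>attached_without_middle_points\<close>): if a point is within \<open>1/2 + \<delta>\<close> of \<open>\<kappa>\<close> points of \<open>D\<^sub>x\<close>, then some point
  added by S lies within \<open>\<delta>\<close> of it; the points added by S are at least \<open>1/2\<close> apart, so a middle
  point of \<open>\<kappa>\<close> points of \<open>D\<^sub>x\<close> is itself one of them, and these were only added for sets that meet
  \<open>D\<^sub>x\<close> in fewer than \<open>\<kappa>\<close> points.

  Conversely, let \<open>W\<close> be a set of at least \<open>\<kappa>\<close> points with mutual distances one that is hereditarily
  without middle points in \<open>X\<kappa>\<close>.  Every \<open>\<kappa>\<close> of its points lie in one stage, where S would have given them a
  middle point unless \<open>\<kappa>\<close> of them lie in one attached set.  As two attached sets cannot both contribute two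
  points to \<open>W\<close>, all but fewer than \<open>\<kappa>\<close> points of \<open>W\<close> lie in a single \<open>D\<^sub>y\<close> (\<open>mostly_attached_set\<close>).

  Now let \<open>f\<close> be an isometry of \<open>X\<kappa>\<close> onto itself.  Up to fewer than \<open>\<kappa>\<close> points, \<open>f\<close> maps \<open>D\<^sub>x\<close> into some
  \<open>D\<^sub>y\<close>, and its inverse maps \<open>D\<^sub>y\<close> back into \<open>D\<^sub>x\<close>; hence \<open>|D\<^sub>x| = |D\<^sub>y|\<close> and \<open>x = y\<close>.  Thus \<open>f x\<close> has distance
  one from more than \<open>\<kappa>\<close> points of \<open>D\<^sub>x\<close>, so \<open>f x \<in> D\<^sub>x \<union> {x}\<close>.  If \<open>f x \<noteq> x\<close>, then \<open>f x\<close> was born later than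
  \<open>x\<close>; but the same applied to the inverse says that \<open>x\<close> was born later than \<open>f x\<close>.

  Superuniversality is the usual back-and-forth argument without the back: the operation F
  realizes every one-point extension of every set of fewer than \<open>\<kappa>\<close> points, and a space of at most \<open>\<kappa>\<close> points
  has a well-order in which each point has fewer than \<open>\<kappa>\<close> predecessors.
\<close>


section \<open>Amalgams of metric spaces\<close>

lemma mdist_self [simp]: "x \<in> mspace m \<Longrightarrow> mdist m x x = 0"
  by simp

text \<open>
  The sequences of an amalgam together with their lengths, as an inductive predicate: rule induction then
  takes the place of arithmetic with indices.
\<close>

inductive chain :: "'a metric set \<Rightarrow> 'a \<Rightarrow> 'a \<Rightarrow> real \<Rightarrow> bool" for \<M> where
  stay: "chain \<M> x x 0"
| step: "\<lbrakk>m \<in> \<M>; x \<in> mspace m; y \<in> mspace m; chain \<M> y w c\<rbrakk> \<Longrightarrow> chain \<M> x w (mdist m x y + c)"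

lemma chain_of_sequence:
  assumes "\<forall>i<n. m i \<in> \<M> \<and> z i \<in> mspace (m i) \<and> z (Suc i) \<in> mspace (m i)"
  shows "chain \<M> (z 0) (z n) (\<Sum>i<n. mdist (m i) (z i) (z (Suc i)))"
  using assms
proof (induction n arbitrary: z m)
  case 0
  then show ?case by (simp add: stay)
next
  case (Suc n)
  have "chain \<M> (z (Suc 0)) (z (Suc n)) (\<Sum>i<n. mdist (m (Suc i)) (z (Suc i)) (z (Suc (Suc i))))"
    using Suc.IH[of "\<lambda>i. m (Suc i)" "\<lambda>i. z (Suc i)"] Suc.prems by simp
  with Suc.prems show ?case
    by (auto simp del: sum.lessThan_Suc simp: sum.lessThan_Suc_shift intro!: step)
qed

lemma sequence_of_chain:
  assumes "chain \<M> x y c"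
  shows "\<exists>(n :: nat) m z. c = (\<Sum>i<n. mdist (m i) (z i) (z (Suc i))) \<and> z 0 = x \<and> z n = y \<and>
    (\<forall>i<n. m i \<in> \<M> \<and> z i \<in> mspace (m i) \<and> z (Suc i) \<in> mspace (m i))"
  using assms
proof induction
  case (stay x)
  show ?case by (rule exI[of _ 0], rule exI[of _ undefined], rule exI[of _ "\<lambda>_. x"]) simp
next
  case (step k x y w c)
  then obtain n :: nat and m z where *: "c = (\<Sum>i<n. mdist (m i) (z i) (z (Suc i)))" "z 0 = y" "z n = w"
    "\<forall>i<n. m i \<in> \<M> \<and> z i \<in> mspace (m i) \<and> z (Suc i) \<in> mspace (m i)" by blast
  show ?case
    by (rule exI[of _ "Suc n"], rule exI[of _ "case_nat k m"], rule exI[of _ "case_nat x z"])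
      (use * step.hyps in \<open>auto simp del: sum.lessThan_Suc simp: sum.lessThan_Suc_shift less_Suc_eq_0_disj\<close>)
qed

lemma amalgam_dist_eq_Inf_chain: "amalgam_dist \<M> x y = Inf {c. chain \<M> x y c}"
proof -
  have "chain \<M> x y c \<longleftrightarrow> (\<exists>(n :: nat) m z. c = (\<Sum>i<n. mdist (m i) (z i) (z (Suc i))) \<and> z 0 = x \<and> z n = y \<and>
    (\<forall>i<n. m i \<in> \<M> \<and> z i \<in> mspace (m i) \<and> z (Suc i) \<in> mspace (m i)))" for c
    by (rule iffI, erule sequence_of_chain, elim exE conjE, hypsubst, erule chain_of_sequence)
  then show ?thesis unfolding amalgam_dist_def by presburger
qed

lemma chain_nonneg: "chain \<M> x y c \<Longrightarrow> 0 \<le> c"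
  by (induction rule: chain.induct) auto

lemma chain_trans: "chain \<M> x y c \<Longrightarrow> chain \<M> y w c' \<Longrightarrow> chain \<M> x w (c + c')"
proof (induction rule: chain.induct)
  case (step m x y z c)
  then show ?case using chain.step[of m \<M> x y w "c + c'"] by (simp add: add.assoc)
qed simp

lemma chain_edge: "m \<in> \<M> \<Longrightarrow> x \<in> mspace m \<Longrightarrow> y \<in> mspace m \<Longrightarrow> chain \<M> x y (mdist m x y)"
  using step[OF _ _ _ stay, of m \<M> x y] by simp

lemma chain_sym: "chain \<M> x y c \<Longrightarrow> chain \<M> y x c"
proof (induction rule: chain.induct)
  case (step m x y w c)
  then show ?case using chain_trans[OF step.IH chain_edge[of m \<M> y x]]
    by (simp add: mdist_commute add.commute)
qed (rule stay)

locale amalgamation =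
  fixes X :: "'a metric" and I :: "'s set" and N :: "'s \<Rightarrow> 'a metric"
  assumes amalgamable: "amalgamable X I N"
begin

definition \<M> :: "'a metric set" where "\<M> = insert X (N ` I)"
definition P :: "'a set" where "P = mspace X \<union> (\<Union>s\<in>I. mspace (N s))"
definition \<rho> :: "'a \<Rightarrow> 'a \<Rightarrow> real" where "\<rho> = amalgam_dist \<M>"

lemma agree: "s \<in> I \<Longrightarrow> x \<in> mspace X \<Longrightarrow> y \<in> mspace X \<Longrightarrow> x \<in> mspace (N s) \<Longrightarrow> y \<in> mspace (N s)
    \<Longrightarrow> mdist X x y = mdist (N s) x y"
  using amalgamable unfolding amalgamable_def agree_on_def by blast

lemma meets: "s \<in> I \<Longrightarrow> \<exists>q. q \<in> mspace X \<and> q \<in> mspace (N s)"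
  using amalgamable unfolding amalgamable_def by (meson all_not_in_conv IntE)

lemma piece_unique: "s \<in> I \<Longrightarrow> t \<in> I \<Longrightarrow> x \<in> mspace (N s) \<Longrightarrow> x \<in> mspace (N t) \<Longrightarrow> x \<notin> mspace X
    \<Longrightarrow> s = t"
  using amalgamable unfolding amalgamable_def by blast

lemma connected_to_core: "x \<in> P \<Longrightarrow> \<exists>q\<in>mspace X. \<exists>c. chain \<M> x q c"
proof (cases "x \<in> mspace X")
  case False
  assume "x \<in> P"
  with False obtain s where "s \<in> I" "x \<in> mspace (N s)" unfolding P_def by blast
  then show ?thesis using meets[of s] chain_edge[of "N s" \<M> x] unfolding \<M>_def by blast
next
  case True
  then show ?thesis using stay[of \<M> x] by blast
qed

lemma connected:
  assumes "x \<in> P" "y \<in> P" shows "\<exists>c. chain \<M> x y c"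
proof -
  obtain p c where p: "p \<in> mspace X" "chain \<M> x p c" using connected_to_core assms(1) by blast
  obtain q c' where q: "q \<in> mspace X" "chain \<M> y q c'" using connected_to_core assms(2) by blast
  have "X \<in> \<M>" unfolding \<M>_def by blast
  from chain_trans[OF p(2) chain_trans[OF chain_edge[OF this p(1) q(1)] chain_sym[OF q(2)]]]
  show ?thesis by blast
qed

lemma \<rho>_le: "chain \<M> x y c \<Longrightarrow> \<rho> x y \<le> c"
  unfolding \<rho>_def amalgam_dist_eq_Inf_chain
  by (rule cInf_lower) (auto intro!: bdd_belowI[of _ 0] dest: chain_nonneg)

lemma \<rho>_ge:
  assumes "x \<in> P" "y \<in> P" "\<And>c. chain \<M> x y c \<Longrightarrow> b \<le> c" shows "b \<le> \<rho> x y"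
  unfolding \<rho>_def amalgam_dist_eq_Inf_chain
  by (rule cInf_greatest) (use assms connected in auto)

lemma \<rho>_nearly:
  assumes "x \<in> P" "y \<in> P" "\<epsilon> > 0" shows "\<exists>c. chain \<M> x y c \<and> c < \<rho> x y + \<epsilon>"
proof (rule ccontr)
  assume "\<not> ?thesis"
  then have "\<rho> x y + \<epsilon> \<le> \<rho> x y" by (intro \<rho>_ge assms) force
  with assms show False by simp
qed

lemma \<rho>_sym: "\<rho> x y = \<rho> y x"
proof -
  have "{c. chain \<M> x y c} = {c. chain \<M> y x c}" by (intro Collect_cong iffI; erule chain_sym)
  then show ?thesis unfolding \<rho>_def amalgam_dist_eq_Inf_chain by simp
qed

lemma \<rho>_nonneg: "x \<in> P \<Longrightarrow> y \<in> P \<Longrightarrow> 0 \<le> \<rho> x y"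
  by (rule \<rho>_ge) (auto dest: chain_nonneg)

lemma \<rho>_triangle:
  assumes "x \<in> P" "y \<in> P" "w \<in> P" shows "\<rho> x w \<le> \<rho> x y + \<rho> y w"
proof (rule field_le_epsilon)
  fix e :: real assume "e > 0"
  then have e: "e/2 > 0" by simp
  obtain c where c: "chain \<M> x y c" "c < \<rho> x y + e/2" using \<rho>_nearly[OF assms(1,2) e] by blast
  obtain c' where c': "chain \<M> y w c'" "c' < \<rho> y w + e/2" using \<rho>_nearly[OF assms(2,3) e] by blast
  show "\<rho> x w \<le> \<rho> x y + \<rho> y w + e" using \<rho>_le[OF chain_trans[OF c(1) c'(1)]] c c' by linarith
qed

text \<open>
  By the triangle inequality in the pieces, every excursion of a chain into a piece can be replaced by one
  step between core points.  The second part of the conclusion is what the induction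
  needs for a chain that starts inside a piece.
\<close>

lemma chain_to_core:
  assumes "chain \<M> x w c" "w \<in> mspace X"
  shows "(x \<in> mspace X \<longrightarrow> mdist X x w \<le> c) \<and>
    (\<forall>s\<in>I. x \<in> mspace (N s) \<longrightarrow>
       (\<exists>q. q \<in> mspace X \<and> q \<in> mspace (N s) \<and> mdist (N s) x q + mdist X q w \<le> c))"
  using assms
proof (induction rule: chain.induct)
  case (stay x)
  then show ?case by (auto intro!: exI[of _ x])
next
  case (step m x y w c)
  note IH = step.IH[OF step.prems]
  have core: "mdist X x w \<le> mdist m x y + c" if x: "x \<in> mspace X"
  proof (cases "m = X")
    case True
    then show ?thesis using IH step.hyps step.prems mdist_triangle[of x X y w] by auto
  next
    case False
    then obtain t where t: "t \<in> I" "m = N t" using step.hyps unfolding \<M>_def by blast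
    then obtain q where q: "q \<in> mspace X" "q \<in> mspace (N t)" "mdist (N t) y q + mdist X q w \<le> c"
      using IH step.hyps by blast
    have "mdist X x q \<le> mdist m x y + mdist (N t) y q"
      using agree[of t x q] t q x step.hyps mdist_triangle[of x "N t" y q] by simp
    then show ?thesis using mdist_triangle[of x X q w] x q step.prems by linarith
  qed
  have "\<exists>q. q \<in> mspace X \<and> q \<in> mspace (N s) \<and> mdist (N s) x q + mdist X q w \<le> mdist m x y + c"
    if s: "s \<in> I" "x \<in> mspace (N s)" for s
  proof (cases "x \<in> mspace X")
    case True
    then show ?thesis using core s by (intro exI[of _ x]) auto
  next
    case False
    then have "m = N s" using step.hyps s piece_unique unfolding \<M>_def by auto
    moreover obtain q where q: "q \<in> mspace X" "q \<in> mspace (N s)" "mdist (N s) y q + mdist X q w \<le> c"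
      using IH step.hyps \<open>m = N s\<close> s by blast
    ultimately show ?thesis using mdist_triangle[of x "N s" y q] step.hyps
      by (intro exI[of _ q]) auto
  qed
  with core show ?case by blast
qed

text \<open>
  A point of a piece outside the core lies in no other member of the family, so a chain can leave the
  piece only through the core.
\<close>

lemma chain_leaves_piece:
  assumes "chain \<M> x w c" "s \<in> I" "x \<in> mspace (N s)" "w \<notin> mspace (N s)"
  shows "\<exists>q c'. q \<in> mspace X \<and> q \<in> mspace (N s) \<and> chain \<M> q w c' \<and> mdist (N s) x q + c' \<le> c"
  using assms
proof (induction rule: chain.induct)
  case (step m x y w c)
  show ?case
  proof (cases "x \<in> mspace X")
    case True
    then show ?thesis using step.hyps step.prems chain.step[of m \<M> x y w c]
      by (intro exI[of _ x] exI[of _ "mdist m x y + c"]) auto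
  next
    case False
    then have m: "m = N s" using step.hyps step.prems piece_unique unfolding \<M>_def by auto
    then obtain q c' where "q \<in> mspace X" "q \<in> mspace (N s)" "chain \<M> q w c'" "mdist (N s) y q + c' \<le> c"
      using step.IH step.prems step.hyps by blast
    then show ?thesis using mdist_triangle[of x "N s" y q] m step.hyps
      by (intro exI[of _ q] exI[of _ c']) auto
  qed
qed blast

text \<open>
  While the chain stays outside the core, it stays in the piece, where the triangle inequality
  suffices; from its first core point on, \<open>chain_to_core\<close> applies to the reversed chain.
\<close>

lemma chain_within_piece:
  assumes "chain \<M> x w c" "s \<in> I" "x \<in> mspace (N s)" "w \<in> mspace (N s)"
  shows "mdist (N s) x w \<le> c"
proof -
  have core: "mdist (N s) u v \<le> b" if ch: "chain \<M> u v b" and u: "u \<in> mspace (N s)" and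
      v: "v \<in> mspace (N s)" "v \<in> mspace X" for u v b
  proof -
    obtain q where "q \<in> mspace X" "q \<in> mspace (N s)" "mdist (N s) u q + mdist X q v \<le> b"
      using chain_to_core[OF ch v(2)] assms(2) u by blast
    then show ?thesis using agree[of s q v] mdist_triangle[of u "N s" q v] assms(2) u v by auto
  qed
  show ?thesis using assms
  proof (induction rule: chain.induct)
    case (step m x y w c)
    show ?case
    proof (cases "x \<in> mspace X")
      case True
      then show ?thesis
        using core[OF chain_sym[OF chain.step[OF step.hyps]], of ] step.prems by (simp add: mdist_commute)
    next
      case False
      then have m: "m = N s" using step.hyps step.prems piece_unique unfolding \<M>_def by auto
      then show ?thesis using step mdist_triangle[of x "N s" y w] by auto
    qed
  qed auto
qed

lemma \<rho>_core:
  assumes "x \<in> mspace X" "y \<in> mspace X" shows "\<rho> x y = mdist X x y"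
proof (rule antisym)
  show "\<rho> x y \<le> mdist X x y" by (rule \<rho>_le, rule chain_edge) (use assms in \<open>auto simp: \<M>_def\<close>)
  show "mdist X x y \<le> \<rho> x y"
    by (rule \<rho>_ge) (use assms chain_to_core in \<open>auto simp: P_def\<close>)
qed

lemma \<rho>_piece:
  assumes "s \<in> I" "x \<in> mspace (N s)" "y \<in> mspace (N s)" shows "\<rho> x y = mdist (N s) x y"
proof (rule antisym)
  show "\<rho> x y \<le> mdist (N s) x y" by (rule \<rho>_le, rule chain_edge) (use assms in \<open>auto simp: \<M>_def\<close>)
  show "mdist (N s) x y \<le> \<rho> x y"
    by (rule \<rho>_ge) (use assms chain_within_piece in \<open>auto simp: P_def\<close>)
qed

lemma \<rho>_gate:
  assumes "s \<in> I" "x \<in> mspace (N s)" "w \<in> P" "w \<notin> mspace (N s)" "\<epsilon> > 0"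
  shows "\<exists>q. q \<in> mspace X \<and> q \<in> mspace (N s) \<and> mdist (N s) x q + \<rho> q w < \<rho> x w + \<epsilon>"
proof -
  have "x \<in> P" using assms unfolding P_def by blast
  then obtain c where c: "chain \<M> x w c" "c < \<rho> x w + \<epsilon>" using \<rho>_nearly assms by blast
  then obtain q c' where "q \<in> mspace X" "q \<in> mspace (N s)" "chain \<M> q w c'" "mdist (N s) x q + c' \<le> c"
    using chain_leaves_piece assms by blast
  then show ?thesis using \<rho>_le c by (intro exI[of _ q]) fastforce
qed

end

locale amalgam = amalgamation +
  fixes Y
  assumes is_amalgam: "is_amalgam X I N Y"
begin

lemma core_subset: "mspace X \<subseteq> mspace Y" and subset_P: "mspace Y \<subseteq> P"
  and representative: "p \<in> P \<Longrightarrow> \<exists>!y. y \<in> mspace Y \<and> \<rho> p y = 0"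
  and mdist_eq: "x \<in> mspace Y \<Longrightarrow> y \<in> mspace Y \<Longrightarrow> mdist Y x y = \<rho> x y"
  using is_amalgam unfolding is_amalgam_def Let_def P_def \<rho>_def \<M>_def by blast+

lemma core_subspace: "is_subspace X Y"
  unfolding is_subspace_def agree_on_def using core_subset mdist_eq \<rho>_core by (metis subsetD)

lemma new_point_in_piece: "p \<in> mspace Y \<Longrightarrow> p \<notin> mspace X \<Longrightarrow> \<exists>s\<in>I. p \<in> mspace (N s)"
  using subset_P unfolding P_def by blast

lemma mdist_piece:
  "s \<in> I \<Longrightarrow> p \<in> mspace Y \<Longrightarrow> q \<in> mspace Y \<Longrightarrow> p \<in> mspace (N s) \<Longrightarrow> q \<in> mspace (N s)
    \<Longrightarrow> mdist Y p q = mdist (N s) p q"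
  using mdist_eq \<rho>_piece by simp

text \<open>
  New points see the rest of the amalgam only through the common points of their piece and the core: up to
  \<open>\<epsilon>\<close>, every distance is realized by a path through such a point.  All later estimates of distances rest
  on this.
\<close>

lemma mdist_gate:
  assumes "s \<in> I" "p \<in> mspace Y" "p \<in> mspace (N s)" "w \<in> mspace Y" "w \<in> mspace X \<or> w \<notin> mspace (N s)"
    "\<epsilon> > 0"
  shows "\<exists>q. q \<in> mspace X \<and> q \<in> mspace (N s) \<and> mdist Y p q + mdist Y q w < mdist Y p w + \<epsilon>"
proof (cases "w \<in> mspace (N s)")
  case True
  then show ?thesis using assms by (intro exI[of _ w]) auto
next
  case False
  then obtain q where "q \<in> mspace X" "q \<in> mspace (N s)" "mdist (N s) p q + \<rho> q w < \<rho> p w + \<epsilon>"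
    using \<rho>_gate assms subset_P by blast
  then show ?thesis using assms core_subset mdist_eq mdist_piece by (intro exI[of _ q]) auto
qed

text \<open>
  The transversal may omit \<open>p\<close>, but its representative has pseudodistance zero from \<open>p\<close> and hence the same
  distances.
\<close>

lemma piece_point_realized:
  assumes "s \<in> I" "p \<in> mspace (N s)"
  shows "\<exists>y\<in>mspace Y. \<forall>q. q \<in> mspace X \<and> q \<in> mspace (N s) \<longrightarrow> mdist Y y q = mdist (N s) p q"
proof -
  have p: "p \<in> P" using assms unfolding P_def by blast
  then obtain y where y: "y \<in> mspace Y" "\<rho> p y = 0" using representative by blast
  have "mdist Y y q = mdist (N s) p q" if q: "q \<in> mspace X" "q \<in> mspace (N s)" for q
  proof -
    have "y \<in> P" "q \<in> P" using y subset_P q unfolding P_def by auto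
    then have "\<rho> y q = \<rho> p q" using \<rho>_triangle[of y p q] \<rho>_triangle[of p y q] p y \<rho>_sym[of y p] by simp
    then show ?thesis using mdist_eq y q core_subset \<rho>_piece assms by auto
  qed
  with y show ?thesis by blast
qed

text \<open>
  A point that keeps a positive distance from the core is alone in its class, so every transversal contains
  it.
\<close>

lemma separated_point_kept:
  assumes "s \<in> I" "p \<in> mspace (N s)" "\<delta> > 0"
    and far: "\<And>q. q \<in> mspace X \<Longrightarrow> q \<in> mspace (N s) \<Longrightarrow> \<delta> \<le> mdist (N s) p q"
  shows "p \<in> mspace Y"
proof -
  have p: "p \<in> P" using assms unfolding P_def by blast
  then obtain y where y: "y \<in> mspace Y" "\<rho> p y = 0" using representative by blast
  have "y \<in> mspace (N s)"
  proof (rule ccontr)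
    assume "y \<notin> mspace (N s)"
    then obtain q where q: "q \<in> mspace X" "q \<in> mspace (N s)" "mdist (N s) p q + \<rho> q y < 0 + \<delta>"
      using \<rho>_gate[of s p y \<delta>] y subset_P assms by auto
    moreover have "0 \<le> \<rho> q y" using \<rho>_nonneg q y subset_P unfolding P_def by blast
    ultimately show False using far[of q] by linarith
  qed
  then have "p = y" using \<rho>_piece[of s p y] y assms by simp
  with y show ?thesis by simp
qed

end

lemma amalgamI: "is_amalgam X I N Y \<Longrightarrow> amalgam X I N Y"
  by unfold_locales (auto simp: is_amalgam_def)


section \<open>Sums of ordinals and the aleph hierarchy\<close>

lemma ord_sum_iff [simp]:
  "(Inl a, Inl a') \<in> ord_sum r s \<longleftrightarrow> (a, a') \<in> r"
  "(Inr b, Inr b') \<in> ord_sum r s \<longleftrightarrow> (b, b') \<in> s"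
  "(Inl a, Inr b) \<in> ord_sum r s \<longleftrightarrow> a \<in> Field r \<and> b \<in> Field s"
  "(Inr b, Inl a) \<notin> ord_sum r s"
  by (auto simp: ord_sum_def)

lemma Field_ord_sum [simp]: "Field (ord_sum r s) = Inl ` Field r \<union> Inr ` Field s"
  by (fastforce simp: ord_sum_def Field_def)

lemma underS_ord_sum [simp]:
  "Inl a \<in> underS (ord_sum r s) (Inl a') \<longleftrightarrow> a \<in> underS r a'"
  "Inr b \<in> underS (ord_sum r s) (Inr b') \<longleftrightarrow> b \<in> underS s b'"
  "Inl a \<in> underS (ord_sum r s) (Inr b) \<longleftrightarrow> a \<in> Field r \<and> b \<in> Field s"
  "Inr b \<notin> underS (ord_sum r s) (Inl a)"
  by (auto simp: underS_def)

lemma total_on_ord_sum: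
  "total_on (Field r) r \<Longrightarrow> total_on (Field s) s \<Longrightarrow> total_on (Field (ord_sum r s)) (ord_sum r s)"
  unfolding total_on_def by (auto; metis)

lemma wf_ord_sum:
  assumes "wf (r - Id)" "wf (s - Id)" shows "wf (ord_sum r s - Id)"
proof (rule wfI_min)
  fix Q and x :: "'a + 'b" assume x: "x \<in> Q"
  show "\<exists>z\<in>Q. \<forall>y. (y, z) \<in> ord_sum r s - Id \<longrightarrow> y \<notin> Q"
  proof (cases "\<exists>a. Inl a \<in> Q")
    case True
    then obtain a where "a \<in> {a. Inl a \<in> Q}" by blast
    then obtain z where "Inl z \<in> Q" "\<And>y. (y, z) \<in> r - Id \<Longrightarrow> Inl y \<notin> Q"
      using wfE_min[OF assms(1)] by (metis mem_Collect_eq)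
    then show ?thesis by (intro bexI[of _ "Inl z"]) (auto simp: split_sum_all)
  next
    case False
    then obtain b where "b \<in> {b. Inr b \<in> Q}" using x by (cases x) auto
    then obtain z where "Inr z \<in> Q" "\<And>y. (y, z) \<in> s - Id \<Longrightarrow> Inr y \<notin> Q"
      using wfE_min[OF assms(2)] by (metis mem_Collect_eq)
    then show ?thesis using False by (intro bexI[of _ "Inr z"]) (auto simp: split_sum_all)
  qed
qed

text \<open>
  A cardinal below \<open>|D|\<close> is a proper initial segment of the well-order \<open>|D|\<close>, cut off by a point of \<open>D\<close>.
\<close>

lemma ordLess_witness:
  assumes "|C| <o |D|" shows "\<exists>a\<in>D. |C| =o Restr |D| (underS |D| a)"
  using assms ordLess_iff_ordIso_Restr[OF card_of_Well_order card_of_Well_order, of C D]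
  by (simp add: Field_card_of)

text \<open>
  Different cardinals below \<open>|D|\<close> cut off initial segments of \<open>|D|\<close> at different points of \<open>D\<close>.
\<close>

lemma card_le_of_strict_cardinals:
  assumes smaller: "\<And>j. j \<in> J \<Longrightarrow> |h j| <o |D|"
    and distinct: "\<And>i j. i \<in> J \<Longrightarrow> j \<in> J \<Longrightarrow> i \<noteq> j \<Longrightarrow> \<not> |h i| =o |h j|"
  shows "|J| \<le>o |D|"
proof -
  have "\<forall>j\<in>J. \<exists>a. a \<in> D \<and> |h j| =o Restr |D| (underS |D| a)" using ordLess_witness smaller by blast
  then obtain g where g: "\<And>j. j \<in> J \<Longrightarrow> g j \<in> D \<and> |h j| =o Restr |D| (underS |D| (g j))"
    by metis
  have "inj_on g J"
  proof (rule inj_onI)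
    fix i j assume "i \<in> J" "j \<in> J" "g i = g j"
    then have "|h i| =o |h j|" using g ordIso_transitive ordIso_symmetric by metis
    then show "i = j" using distinct \<open>i \<in> J\<close> \<open>j \<in> J\<close> by blast
  qed
  then show ?thesis using g card_of_ordLeq[of J D] by blast
qed

text \<open>
  The alephs with index below \<open>e\<close> are distinct cardinals below \<open>\<aleph>\<^sub>e\<close>, so \<open>\<aleph>\<^sub>e\<close> is at least the
  cardinality of \<open>e\<close>; and \<open>|D|\<close> is an aleph with a larger index.
\<close>

lemma has_card_aleph_greater:
  assumes "has_card_aleph r D" "total_on (Field r) r" "e \<in> Field r"
  shows "|underS r e| <o |D|"
proof -
  obtain h where h: "\<And>i. i \<in> Field r \<Longrightarrow> least_infinite_above (h ` underS r i) (h i)"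
    and D: "least_infinite_above (h ` Field r) D"
    using assms(1) unfolding has_card_aleph_def by blast
  have less: "|h i| <o |h j|" if "i \<in> underS r j" for i j
    using h[of j] that underS_Field2 unfolding least_infinite_above_def by (metis FieldI2 image_eqI underS_E)
  have "|underS r e| \<le>o |h e|"
  proof (rule card_le_of_strict_cardinals[of _ h])
    fix i j assume ij: "i \<in> underS r e" "j \<in> underS r e" "i \<noteq> j"
    then have "i \<in> Field r" "j \<in> Field r" unfolding underS_def Field_def by auto
    then have "i \<in> underS r j \<or> j \<in> underS r i" using assms(2) ij unfolding total_on_def underS_def by blast
    then show "\<not> |h i| =o |h j|" using less not_ordLess_ordIso ordIso_symmetric by blast
  qed (rule less)
  moreover have "|h e| <o |D|" using D assms(3) unfolding least_infinite_above_def by blast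
  ultimately show ?thesis by (rule ordLeq_ordLess_trans)
qed

text \<open>
  Strict monotonicity of the aleph hierarchy, with \<open>r\<close> mapped strictly increasingly below a point \<open>e\<close> of
  \<open>r'\<close>.  Each \<open>\<aleph>\<^sub>i\<close> is the least cardinal above its predecessors, so well-founded induction along \<open>r\<close> gives
  the inequalities \<open>\<aleph>\<^sub>i \<le> \<aleph>\<^bsub>g i\<^esub>\<close>.
\<close>

lemma has_card_aleph_strict_mono:
  fixes D D' :: "'a set"
  assumes "has_card_aleph r D" "has_card_aleph r' D'" "wf (r - Id)"
    and g: "\<And>i. i \<in> Field r \<Longrightarrow> g i \<in> underS r' e"
    and mono: "\<And>i j. i \<in> underS r j \<Longrightarrow> g i \<in> underS r' (g j)"
    and e: "e \<in> Field r'"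
  shows "|D| <o |D'|"
proof -
  obtain h where h: "\<And>i. i \<in> Field r \<Longrightarrow> least_infinite_above (h ` underS r i) (h i)"
    and D: "least_infinite_above (h ` Field r) D"
    using assms(1) unfolding has_card_aleph_def by blast
  obtain h' where h': "\<And>i. i \<in> Field r' \<Longrightarrow> least_infinite_above (h' ` underS r' i) (h' i)"
    and D': "least_infinite_above (h' ` Field r') D'"
    using assms(2) unfolding has_card_aleph_def by blast
  have less: "|h' i| <o |h' j|" if "i \<in> underS r' j" for i j
  proof -
    have "j \<in> Field r'" using that unfolding underS_def Field_def by auto
    then show ?thesis using h'[of j] that unfolding least_infinite_above_def by blast
  qed
  have le: "i \<in> Field r \<longrightarrow> |h i| \<le>o |h' (g i)|" for i
  proof (induction i rule: wf_induct_rule[OF assms(3)])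
    case (1 i)
    show ?case
    proof
      assume i: "i \<in> Field r"
      have "g i \<in> Field r'" using g[OF i] unfolding underS_def Field_def by auto
      then have "infinite (h' (g i))" using h' unfolding least_infinite_above_def by blast
      moreover have "\<forall>C\<in>h ` underS r i. |C| <o |h' (g i)|"
      proof clarify
        fix j assume j: "j \<in> underS r i"
        then have "(j, i) \<in> r - Id" "j \<in> Field r" unfolding underS_def Field_def by auto
        then have "|h j| \<le>o |h' (g j)|" using 1 by blast
        then show "|h j| <o |h' (g i)|" using less mono[OF j] ordLeq_ordLess_trans by blast
      qed
      ultimately show "|h i| \<le>o |h' (g i)|" using h[OF i] unfolding least_infinite_above_def by blast
    qed
  qed
  have "infinite (h' e)" using h' e unfolding least_infinite_above_def by blast
  moreover have "\<forall>C\<in>h ` Field r. |C| <o |h' e|"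
    using le less g ordLeq_ordLess_trans by blast
  ultimately have "|D| \<le>o |h' e|" using D unfolding least_infinite_above_def by blast
  moreover have "|h' e| <o |D'|" using D' e unfolding least_infinite_above_def by blast
  ultimately show ?thesis by (rule ordLeq_ordLess_trans)
qed

text \<open>
  The ordinal \<open>\<kappa> + |B| + \<alpha> + 2\<close>, where \<open>\<alpha>\<close> is a point of the well-order \<open>l\<close>.
\<close>

abbreviation attached_index :: "'k rel \<Rightarrow> 'b set \<Rightarrow> 'c rel \<Rightarrow> 'c \<Rightarrow> ('k + 'b + 'c + nat) rel" where
  "attached_index \<kappa> B l \<alpha> \<equiv> ord_sum \<kappa> (ord_sum |B| (ord_sum (ord_below l \<alpha>) (natLeq_on 2)))"

lemma Field_ord_below: "Well_order l \<Longrightarrow> Field (ord_below l \<alpha>) = underS l \<alpha>"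
  by (rule Refl_Field_Restr2)
    (auto simp: underS_Field order_on_defs underS_def Field_def)

lemma total_on_ord_below: "Well_order l \<Longrightarrow> total_on (Field (ord_below l \<alpha>)) (ord_below l \<alpha>)"
  unfolding Field_ord_below by (auto simp: order_on_defs total_on_def underS_def Field_def)

lemma Well_order_wf: "Well_order r \<Longrightarrow> wf (r - Id)" and
  Well_order_total: "Well_order r \<Longrightarrow> total_on (Field r) r"
  by (auto simp: order_on_defs)

lemma attached_cardinality_greater:
  assumes "has_card_aleph (attached_index \<kappa> B l \<alpha>) D" "Card_order \<kappa>" "Well_order l"
  shows "\<kappa> <o |D|" "|B| <o |D|"
proof -
  let ?r = "attached_index \<kappa> B l \<alpha>" and ?e = "Inr (Inr (Inr (0::nat)))"
  have \<kappa>: "Well_order \<kappa>" using assms(2) by (simp add: card_order_on_well_order_on)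
  have tot: "total_on (Field ?r) ?r"
    by (intro total_on_ord_sum Well_order_total total_on_ord_below \<kappa> assms card_of_Well_order)
       (auto simp: natLeq_on_well_order_on Field_natLeq_on total_on_def)
  \<comment> \<open>Below the first of the last two points of the index there are copies of \<open>\<kappa>\<close> and of \<open>B\<close>.\<close>
  have less: "|underS ?r ?e| <o |D|"
    by (rule has_card_aleph_greater[OF assms(1) tot]) (auto simp: Field_natLeq_on)
  have "|Field \<kappa>| \<le>o |underS ?r ?e|"
    by (rule card_of_ordLeqI[of Inl]) (auto simp: underS_def Field_natLeq_on)
  moreover have "|B| \<le>o |underS ?r ?e|"
    by (rule card_of_ordLeqI[of "\<lambda>b. Inr (Inl b)"])
      (auto simp: underS_def Field_natLeq_on Field_card_of intro: inj_onI)
  ultimately show "\<kappa> <o |D|" "|B| <o |D|"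
    using less ordLeq_ordLess_trans ordIso_ordLeq_trans[OF ordIso_symmetric[OF card_of_Field_ordIso[OF assms(2)]]]
    by blast+
qed

text \<open>
  It suffices to map \<open>\<kappa> + |B| + \<alpha> + 2\<close> below the last point of \<open>\<kappa> + |B| + \<beta> + 2\<close>.
\<close>

lemma attached_cardinality_strict_mono:
  fixes D D' :: "'a set"
  assumes "has_card_aleph (attached_index \<kappa> B l \<alpha>) D" "has_card_aleph (attached_index \<kappa> B l \<beta>) D'"
    and "Well_order \<kappa>" "Well_order l" "(\<alpha>, \<beta>) \<in> l" "\<alpha> \<noteq> \<beta>"
  shows "|D| <o |D'|"
proof -
  \<comment> \<open>The first of the two last points goes to \<open>\<alpha>\<close>, which lies below \<open>\<beta>\<close>, and the second one goes to the first of
    the two last points on the other side.  This covers \<open>\<beta> = \<alpha> + 1\<close> as well.\<close>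
  define g :: "'b + 'c + 'd + nat \<Rightarrow> 'b + 'c + 'd + nat" where
    "g x = (case x of Inr (Inr (Inr n)) \<Rightarrow> if n = 0 then Inr (Inr (Inl \<alpha>)) else Inr (Inr (Inr 0)) | _ \<Rightarrow> x)" for x
  have g: "g (Inl k) = Inl k" "g (Inr (Inl b)) = Inr (Inl b)" "g (Inr (Inr (Inl c))) = Inr (Inr (Inl c))"
    "g (Inr (Inr (Inr n))) = (if n = 0 then Inr (Inr (Inl \<alpha>)) else Inr (Inr (Inr 0)))" for k b c n
    by (auto simp: g_def)
  have l: "trans l" "antisym l" using assms(4) by (auto simp: order_on_defs)
  have ab: "Restr l (underS l \<alpha>) \<subseteq> Restr l (underS l \<beta>)" "\<alpha> \<in> underS l \<beta>" "underS l \<alpha> \<subseteq> underS l \<beta>"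
    using l assms(5,6) unfolding underS_def trans_def antisym_def by blast+
  let ?r = "attached_index \<kappa> B l \<alpha>" and ?r' = "attached_index \<kappa> B l \<beta>" and ?e = "Inr (Inr (Inr (1::nat)))"
  have nat: "n \<in> underS (natLeq_on 2) m \<longleftrightarrow> n < m \<and> m < 2" for n m by (auto simp: underS_def)
  have below: "c \<in> underS (ord_below l \<gamma>) c' \<longleftrightarrow> c \<in> underS l c' \<and> c' \<in> underS l \<gamma>" for c c' \<gamma>
    using l unfolding underS_def trans_def antisym_def by blast
  note simps = split_sum_all g nat below Field_natLeq_on Field_card_of Field_ord_below[OF assms(4)]
  have "\<forall>i. i \<in> Field ?r \<longrightarrow> g i \<in> underS ?r' ?e"
    using ab by (auto simp: simps)
  moreover have "\<forall>j i. i \<in> underS ?r j \<longrightarrow> g i \<in> underS ?r' (g j)"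
    using ab by (auto simp: simps)
  moreover have "wf (ord_below l \<alpha> - Id)" using assms(4) by (auto intro: wf_subset[OF Well_order_wf])
  moreover have "wf (natLeq_on 2 - Id)"
    using natLeq_on_well_order_on[of 2] Field_natLeq_on[of 2] by (intro Well_order_wf) simp
  ultimately show ?thesis
    by (intro has_card_aleph_strict_mono[OF assms(1,2), of g ?e] wf_ord_sum
        Well_order_wf[OF assms(3)] Well_order_wf[OF card_of_Well_order])
      (auto simp: Field_natLeq_on)
qed


section \<open>What the three operations add\<close>

text \<open>
  The piece \<open>D x \<union> {x}\<close> meets the core in \<open>x\<close> alone.  So all paths from \<open>D x\<close> to other points pass
  through \<open>x\<close>, which gives the exact formula for the distances.  As the points of \<open>D x\<close> have distance one
  from \<open>x\<close>, all of them survive the passage to the transversal.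
\<close>

lemma attached_set_structure:
  fixes \<kappa> :: "'k rel" and X :: "'a metric"
  assumes A: "is_A \<kappa> X Y AX \<A>" and \<kappa>: "Card_order \<kappa>"
  obtains D where
    "is_subspace X AX"
    "mspace AX = mspace X \<union> (\<Union>x\<in>mspace X - Y. D x)"
    "\<A> = (\<lambda>x. insert x (D x)) ` (mspace X - Y)"
    "\<And>x. x \<in> mspace X - Y \<Longrightarrow> D x \<inter> mspace X = {}"
    "\<And>x a b. x \<in> mspace X - Y \<Longrightarrow> a \<in> D x \<Longrightarrow> b \<in> D x \<Longrightarrow> a \<noteq> b \<Longrightarrow> mdist AX a b = 1"
    "\<And>x a b. x \<in> mspace X - Y \<Longrightarrow> a \<in> D x \<Longrightarrow> b \<in> mspace AX - D x \<Longrightarrow> mdist AX a b = 1 + mdist AX x b"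
    "\<And>x. x \<in> mspace X - Y \<Longrightarrow> \<kappa> <o |D x|"
    "\<And>x. x \<in> mspace X - Y \<Longrightarrow> |mspace X| <o |D x|"
    "\<And>x y. x \<in> mspace X - Y \<Longrightarrow> y \<in> mspace X - Y \<Longrightarrow> x \<noteq> y \<Longrightarrow> D x \<inter> D y = {}"
    "\<And>x y. x \<in> mspace X - Y \<Longrightarrow> y \<in> mspace X - Y \<Longrightarrow> |D x| =o |D y| \<Longrightarrow> x = y"
proof -
  let ?B = "mspace X - Y"
  from A obtain e :: "'a \<Rightarrow> 'a" and D' :: "'a \<Rightarrow> 'a set" and N :: "'a \<Rightarrow> 'a metric" where
    e: "bij_betw e ?B ?B" and disj: "disjoint_family_on D' ?B"
    and D': "\<And>\<alpha>. \<alpha> \<in> ?B \<Longrightarrow> D' \<alpha> \<inter> mspace X = {} \<and>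
              has_card_aleph (attached_index \<kappa> (mspace X) |?B| \<alpha>) (D' \<alpha>) \<and>
              mspace (N \<alpha>) = insert (e \<alpha>) (D' \<alpha>) \<and> is_discrete (N \<alpha>)"
    and am: "is_amalgam X ?B N AX"
    and fam: "\<A> = (\<lambda>\<alpha>. insert (e \<alpha>) (D' \<alpha>)) ` ?B"
    unfolding is_A_def Let_def Field_card_of by blast
  interpret amalgam X ?B N AX by (rule amalgamI[OF am])
  define i where "i = inv_into ?B e"
  have i: "i x \<in> ?B" "e (i x) = x" if "x \<in> ?B" for x
    using bij_betw_imp_surj_on[OF e] inv_into_into[of x e ?B] f_inv_into_f[of x e ?B] that
    unfolding i_def by auto
  have ie: "i (e \<alpha>) = \<alpha>" "e \<alpha> \<in> ?B" if "\<alpha> \<in> ?B" for \<alpha>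
    using bij_betw_inv_into_left[OF e that] bij_betwE[OF e] that unfolding i_def by auto
  define D where "D x = D' (i x)" for x
  have piece: "mspace (N (i x)) = insert x (D x)" if "x \<in> ?B" for x
    using D'[OF i(1)[OF that]] i[OF that] unfolding D_def by simp
  have new: "D x \<inter> mspace X = {}" if "x \<in> ?B" for x
    using D'[OF i(1)[OF that]] unfolding D_def by simp
  have one: "mdist (N (i x)) a b = 1" if "x \<in> ?B" "a \<in> insert x (D x)" "b \<in> insert x (D x)" "a \<noteq> b" for x a b
  proof -
    have "mdist (N (i x)) a b \<in> {0, 1}"
      using D'[OF i(1)[OF that(1)]] that piece unfolding is_discrete_def by auto
    then show ?thesis using that piece by auto
  qed
  have in_AX: "D x \<subseteq> mspace AX" if x: "x \<in> ?B" for x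
  proof
    fix a assume a: "a \<in> D x"
    show "a \<in> mspace AX"
    proof (rule separated_point_kept[of "i x" a 1])
      fix q assume "q \<in> mspace X" "q \<in> mspace (N (i x))"
      then show "1 \<le> mdist (N (i x)) a q" using one[OF x, of a q] new[OF x] piece[OF x] a
        by (cases "a = q") auto
    qed (use a x i piece in auto)
  qed
  have "mspace AX = mspace X \<union> (\<Union>x\<in>?B. D x)"
  proof
    show "mspace AX \<subseteq> mspace X \<union> (\<Union>x\<in>?B. D x)"
    proof
      fix p assume p: "p \<in> mspace AX"
      show "p \<in> mspace X \<union> (\<Union>x\<in>?B. D x)"
      proof (cases "p \<in> mspace X")
        case False
        then obtain \<alpha> where \<alpha>: "\<alpha> \<in> ?B" "p \<in> mspace (N \<alpha>)" using new_point_in_piece p by blast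
        then have "p \<in> insert (e \<alpha>) (D (e \<alpha>))" using piece[OF ie(2)] ie by simp
        then show ?thesis using ie(2)[OF \<alpha>(1)] False by auto
      qed simp
    qed
  qed (use core_subset in_AX in auto)
  moreover have "\<A> = (\<lambda>x. insert x (D x)) ` ?B"
  proof -
    have "\<A> = (\<lambda>x. insert x (D x)) ` (e ` ?B)"
      unfolding fam image_image by (rule image_cong) (auto simp: D_def ie)
    then show ?thesis using bij_betw_imp_surj_on[OF e] by simp
  qed
  moreover have "mdist AX a b = 1" if "x \<in> ?B" "a \<in> D x" "b \<in> D x" "a \<noteq> b" for x a b
    using mdist_piece[of "i x" a b] one[of x a b] piece[of x] i[of x] in_AX[OF that(1)] that by auto
  moreover have "mdist AX a b = 1 + mdist AX x b" if x: "x \<in> ?B" and a: "a \<in> D x" and b: "b \<in> mspace AX - D x" for x a b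
  proof -
    have in': "a \<in> mspace AX" "x \<in> mspace AX" "b \<in> mspace AX" using in_AX[OF x] x a b core_subset by auto
    have ax: "mdist AX a x = 1"
      using mdist_piece[of "i x" a x] one[of x a x] piece[of x] i in' new[OF x] x a
      by (cases "a = x") auto
    have "1 + mdist AX x b \<le> mdist AX a b"
    proof (rule field_le_epsilon)
      fix \<epsilon> :: real assume "\<epsilon> > 0"
      then obtain q where "q \<in> mspace X" "q \<in> mspace (N (i x))" "mdist AX a q + mdist AX q b < mdist AX a b + \<epsilon>"
        using mdist_gate[of "i x" a b \<epsilon>] in' i x piece[OF x] a b by auto
      then show "1 + mdist AX x b \<le> mdist AX a b + \<epsilon>" using ax new[OF x] piece[OF x] by auto
    qed
    then show ?thesis using ax mdist_triangle[of a AX x b] in' by linarith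
  qed
  moreover have "\<kappa> <o |D x|" "|mspace X| <o |D x|" if "x \<in> ?B" for x
    using attached_cardinality_greater[of \<kappa> "mspace X" "|?B|" "i x" "D x"] D'[OF i(1)[OF that]] \<kappa> card_of_Well_order
    unfolding D_def by blast+
  moreover have "D x \<inter> D y = {}" if "x \<in> ?B" "y \<in> ?B" "x \<noteq> y" for x y
    using disj i that unfolding D_def disjoint_family_on_def by metis
  moreover have "x = y" if "x \<in> ?B" "y \<in> ?B" "|D x| =o |D y|" for x y
  proof (rule ccontr)
    assume "x \<noteq> y"
    then have ne: "i x \<noteq> i y" using i that by metis
    have aleph: "has_card_aleph (attached_index \<kappa> (mspace X) |?B| (i x)) (D x)"
      "has_card_aleph (attached_index \<kappa> (mspace X) |?B| (i y)) (D y)"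
      using D'[OF i(1)] that unfolding D_def by blast+
    have "Well_order \<kappa>" using \<kappa> by (simp add: card_order_on_well_order_on)
    note less = attached_cardinality_strict_mono[OF aleph this card_of_Well_order]
      attached_cardinality_strict_mono[OF aleph(2,1) this card_of_Well_order]
    have "(i x, i y) \<in> |?B| \<or> (i y, i x) \<in> |?B|"
      using Well_order_total[OF card_of_Well_order, of ?B] ne i that unfolding total_on_def Field_card_of by blast
    then have "|D x| <o |D y| \<or> |D y| <o |D x|" using less ne by auto
    then show False using that not_ordLess_ordIso ordIso_symmetric by blast
  qed
  ultimately show ?thesis using that[of D] core_subspace new by blast
qed

text \<open>
  The piece of \<open>Y\<close> meets the core in \<open>Y\<close>, so every path from the new point to another point starts with an edge of
  length \<open>1/2\<close> into \<open>Y\<close>.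
\<close>

lemma middle_point_extension_structure:
  fixes \<kappa> :: "'k rel" and X :: "'a metric"
  assumes S: "is_S \<kappa> X \<G> SX"
  shows "is_subspace X SX"
    and "\<And>z. z \<in> mspace SX - mspace X \<Longrightarrow> \<exists>Y\<in>discrete_without_middle_points \<kappa> X.
          (\<forall>Z\<in>\<G>. |Y \<inter> Z| <o \<kappa>) \<and>
          (\<forall>b\<in>mspace SX - {z}. \<forall>\<epsilon>>0. \<exists>y\<in>Y. 1/2 + mdist SX y b < mdist SX z b + \<epsilon>)"
    and "\<And>Y. Y \<in> discrete_without_middle_points \<kappa> X \<Longrightarrow> \<forall>Z\<in>\<G>. |Y \<inter> Z| <o \<kappa> \<Longrightarrow>
          \<exists>z\<in>mspace SX. \<forall>y\<in>Y. mdist SX z y = 1/2"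
proof -
  define \<Y> where "\<Y> = {Y \<in> discrete_without_middle_points \<kappa> X. \<forall>Z\<in>\<G>. |Y \<inter> Z| <o \<kappa>}"
  obtain z N where
    N': "\<forall>Y\<in>\<Y>. z Y \<notin> mspace X \<and> mspace (N Y) = insert (z Y) Y \<and> agree_on Y X (N Y) \<and>
              (\<forall>y\<in>Y. mdist (N Y) (z Y) y = 1/2)"
    and am: "is_amalgam X \<Y> N SX"
    using S unfolding is_S_def Let_def \<Y>_def[symmetric] by (elim exE conjE) (rule that)
  note N = bspec[OF N']
  interpret amalgam X \<Y> N SX by (rule amalgamI[OF am])
  have sub: "Y \<subseteq> mspace X" if "Y \<in> \<Y>" for Y
    using that unfolding \<Y>_def discrete_without_middle_points_def by blast
  show "is_subspace X SX" by (rule core_subspace)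
  show "\<exists>z\<in>mspace SX. \<forall>y\<in>Y. mdist SX z y = 1/2"
    if "Y \<in> discrete_without_middle_points \<kappa> X" "\<forall>Z\<in>\<G>. |Y \<inter> Z| <o \<kappa>" for Y
  proof -
    have Y: "Y \<in> \<Y>" using that unfolding \<Y>_def by blast
    then obtain y where y: "y \<in> mspace SX" "\<forall>q. q \<in> mspace X \<and> q \<in> mspace (N Y) \<longrightarrow> mdist SX y q = mdist (N Y) (z Y) q"
      using piece_point_realized[of Y "z Y"] N by auto
    show ?thesis using y(2) N[OF Y] sub[OF Y] by (intro bexI[OF _ y(1)]) auto
  qed
  show "\<exists>Y\<in>discrete_without_middle_points \<kappa> X.
          (\<forall>Z\<in>\<G>. |Y \<inter> Z| <o \<kappa>) \<and>
          (\<forall>b\<in>mspace SX - {w}. \<forall>\<epsilon>>0. \<exists>y\<in>Y. 1/2 + mdist SX y b < mdist SX w b + \<epsilon>)"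
    if w: "w \<in> mspace SX - mspace X" for w
  proof -
    obtain Y where Y: "Y \<in> \<Y>" "w \<in> mspace (N Y)" using new_point_in_piece w by blast
    then have wz: "w = z Y" using N[OF Y(1)] sub[OF Y(1)] w by auto
    have "\<exists>y\<in>Y. 1/2 + mdist SX y b < mdist SX w b + \<epsilon>" if b: "b \<in> mspace SX - {w}" and \<epsilon>: "\<epsilon> > 0" for b and \<epsilon> :: real
    proof -
      have "b \<in> mspace X \<or> b \<notin> mspace (N Y)" using b N[OF Y(1)] wz sub[OF Y(1)] by auto
      then obtain q where q: "q \<in> mspace X" "q \<in> mspace (N Y)" "mdist SX w q + mdist SX q b < mdist SX w b + \<epsilon>"
        using mdist_gate[of Y w b \<epsilon>] Y w b \<epsilon> by blast
      then have "q \<in> Y" using N[OF Y(1)] by auto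
      moreover have "mdist SX w q = 1/2"
        using mdist_piece[of Y w q] N[OF Y(1)] wz q Y w core_subset \<open>q \<in> Y\<close> by auto
      ultimately show ?thesis using q by (intro bexI[of _ q]) auto
    qed
    then show ?thesis using Y(1) unfolding \<Y>_def by blast
  qed
qed

text \<open>
  The function \<open>e\<close> prescribes the distances of a new point; the two inequalities say that it
  satisfies the triangle inequality with the points of \<open>E\<close>.
\<close>

lemma one_point_extension_structure:
  fixes \<kappa> :: "'k rel" and X :: "'a metric"
  assumes F: "is_F \<kappa> X FX"
  shows "is_subspace X FX"
    and "\<And>p. p \<in> mspace FX - mspace X \<Longrightarrow> \<exists>E\<subseteq>mspace X. |E| <o \<kappa> \<and>
          (\<forall>b\<in>mspace X. \<forall>\<epsilon>>0. \<exists>q\<in>E. mdist FX p q + mdist FX q b < mdist FX p b + \<epsilon>)"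
    and "\<And>E e. E \<subseteq> mspace X \<Longrightarrow> |E| <o \<kappa> \<Longrightarrow> E \<noteq> {} \<Longrightarrow> \<forall>q\<in>E. 0 < e q \<Longrightarrow>
          \<forall>q\<in>E. \<forall>q'\<in>E. e q \<le> mdist X q q' + e q' \<and> mdist X q q' \<le> e q + e q' \<Longrightarrow>
          \<exists>p\<in>mspace FX. \<forall>q\<in>E. mdist FX p q = e q"
proof -
  obtain l :: "'a rel" and E a and N :: "'a \<Rightarrow> 'a \<Rightarrow> 'a metric" where
    E: "E ` Field l = {Z. Z \<subseteq> mspace X \<and> |Z| <o \<kappa> \<and> Z \<noteq> {}}"
    and N': "\<forall>\<alpha>\<in>Field l. \<forall>\<beta>\<in>Field l. a \<alpha> \<beta> \<notin> mspace X \<and>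
           mspace (N \<alpha> \<beta>) = insert (a \<alpha> \<beta>) (E \<alpha>) \<and> agree_on (E \<alpha>) X (N \<alpha> \<beta>)"
    and ext: "\<forall>\<alpha>\<in>Field l. \<forall>(T :: 'a metric) t f0. t \<in> mspace T \<and>
           isometry_onto (submetric T (mspace T - {t})) (submetric X (E \<alpha>)) f0 \<longrightarrow>
           (\<exists>\<beta>\<in>Field l. \<exists>f. isometry_onto T (N \<alpha> \<beta>) f \<and> (\<forall>x\<in>mspace T - {t}. f x = f0 x))"
    and am: "is_amalgam X (Field l \<times> Field l) (\<lambda>(\<alpha>, \<beta>). N \<alpha> \<beta>) FX"
    using F unfolding is_F_def by (elim exE conjE) (rule that)
  note N = bspec[OF bspec[OF N']]
  interpret amalgam X "Field l \<times> Field l" "\<lambda>(\<alpha>, \<beta>). N \<alpha> \<beta>" FX by (rule amalgamI[OF am])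
  have E_sub: "E \<alpha> \<subseteq> mspace X" "|E \<alpha>| <o \<kappa>" if "\<alpha> \<in> Field l" for \<alpha> using E that by blast+
  show "is_subspace X FX" by (rule core_subspace)
  show "\<exists>E\<subseteq>mspace X. |E| <o \<kappa> \<and>
          (\<forall>b\<in>mspace X. \<forall>\<epsilon>>0. \<exists>q\<in>E. mdist FX p q + mdist FX q b < mdist FX p b + \<epsilon>)"
    if p: "p \<in> mspace FX - mspace X" for p
  proof -
    obtain \<alpha> \<beta> where ab: "\<alpha> \<in> Field l" "\<beta> \<in> Field l" "p \<in> mspace (N \<alpha> \<beta>)"
      using new_point_in_piece[of p] p by auto
    have "\<exists>q\<in>E \<alpha>. mdist FX p q + mdist FX q b < mdist FX p b + \<epsilon>" if b: "b \<in> mspace X" "\<epsilon> > 0" for b and \<epsilon> :: real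
    proof -
      obtain q where "q \<in> mspace X" "q \<in> mspace (N \<alpha> \<beta>)" "mdist FX p q + mdist FX q b < mdist FX p b + \<epsilon>"
        using mdist_gate[of "(\<alpha>, \<beta>)" p b \<epsilon>] ab p b core_subset by auto
      then show ?thesis using N[OF ab(1,2)] by auto
    qed
    then show ?thesis using E_sub[OF ab(1)] by blast
  qed
  show "\<exists>p\<in>mspace FX. \<forall>q\<in>E'. mdist FX p q = e q"
    if E': "E' \<subseteq> mspace X" "|E'| <o \<kappa>" "E' \<noteq> {}" and pos: "\<forall>q\<in>E'. 0 < e q"
      and kat: "\<forall>q\<in>E'. \<forall>q'\<in>E'. e q \<le> mdist X q q' + e q' \<and> mdist X q q' \<le> e q + e q'" for E' e
  proof -
    have "E' \<in> E ` Field l" unfolding E using E' by blast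
    then obtain \<alpha> where \<alpha>: "\<alpha> \<in> Field l" "E \<alpha> = E'" by blast
    \<comment> \<open>Any point outside \<open>X\<close> serves as the new point of the test space.\<close>
    define t where "t = a \<alpha> \<alpha>"
    have t: "t \<notin> mspace X" "t \<notin> E'" using N[OF \<alpha>(1) \<alpha>(1)] E' unfolding t_def by auto
    \<comment> \<open>Absolute values make this nonnegative everywhere, as the type of metrics requires.\<close>
    define D where "D x y = (if x = t then if y = t then 0 else \<bar>e y\<bar> else if y = t then \<bar>e x\<bar> else mdist X x y)" for x y
    have D: "D t t = 0" "\<And>q. q \<in> E' \<Longrightarrow> D t q = e q" "\<And>q. q \<in> E' \<Longrightarrow> D q t = e q"
      "\<And>q q'. q \<in> E' \<Longrightarrow> q' \<in> E' \<Longrightarrow> D q q' = mdist X q q'"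
      using t pos unfolding D_def by auto
    interpret T: Metric_space "insert t E'" D
    proof
      show "0 \<le> D x y" for x y unfolding D_def by simp
      show "D x y = D y x" for x y unfolding D_def by (simp add: mdist_commute)
      have X: "q \<in> mspace X" if "q \<in> E'" for q using that E'(1) by blast
      have pos': "0 < e q" "0 \<le> e q" "e q \<noteq> 0" if "q \<in> E'" for q using pos that by force+
      show "D x y = 0 \<longleftrightarrow> x = y" if "x \<in> insert t E'" "y \<in> insert t E'" for x y
        using that t(2) by (elim insertE) (auto simp: D pos' X)
      have kat': "e q \<le> mdist X q q' + e q'" "e q \<le> e q' + mdist X q' q" "mdist X q q' \<le> e q + e q'"
        if "q \<in> E'" "q' \<in> E'" for q q'
        using bspec[OF bspec[OF kat that(1)] that(2)] mdist_commute[of X q q'] by auto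
      show "D x z \<le> D x y + D y z" if "x \<in> insert t E'" "y \<in> insert t E'" "z \<in> insert t E'" for x y z
        using that by (elim insertE) (simp_all add: D pos' kat' X mdist_triangle)
    qed
    define T where "T = metric (insert t E', D)"
    have T: "mspace T = insert t E'" "mdist T = D" unfolding T_def by simp_all
    have "isometry_onto (submetric T (mspace T - {t})) (submetric X (E \<alpha>)) id"
      using t E'(1) D(4) unfolding isometry_onto_def isometric_embedding_def by (auto simp: T \<alpha>(2))
    with bspec[OF ext \<alpha>(1), rule_format, of t T id] T obtain \<beta> f where \<beta>: "\<beta> \<in> Field l"
      and f: "isometry_onto T (N \<alpha> \<beta>) f" "\<forall>x\<in>mspace T - {t}. f x = x" by auto
    have fE: "f q = q" if "q \<in> E'" for q using f(2) that t T by auto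
    have iso: "mdist (N \<alpha> \<beta>) (f x) (f y) = D x y" "f x \<in> insert (a \<alpha> \<beta>) E'"
      if "x \<in> insert t E'" "y \<in> insert t E'" for x y
      using f(1) that T N[OF \<alpha>(1) \<beta>] \<alpha>(2) unfolding isometry_onto_def isometric_embedding_def by auto
    \<comment> \<open>The isometry fixes \<open>E'\<close>, so it must send \<open>t\<close> to the new point \<open>a \<alpha> \<beta>\<close>.\<close>
    have "f t \<notin> E'"
    proof
      assume "f t \<in> E'"
      then have "mdist (N \<alpha> \<beta>) (f t) (f t) = e (f t)" using iso(1)[of t "f t"] fE D by auto
      then show False using pos \<open>f t \<in> E'\<close> N[OF \<alpha>(1) \<beta>] \<alpha>(2) by auto
    qed
    then have ft: "f t = a \<alpha> \<beta>" using iso(2)[of t t] by auto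
    obtain y where y: "y \<in> mspace FX"
      "\<forall>q. q \<in> mspace X \<and> q \<in> mspace (N \<alpha> \<beta>) \<longrightarrow> mdist FX y q = mdist (N \<alpha> \<beta>) (a \<alpha> \<beta>) q"
      using piece_point_realized[of "(\<alpha>, \<beta>)" "a \<alpha> \<beta>"] N[OF \<alpha>(1) \<beta>] \<alpha>(1) \<beta> by auto
    have "mdist FX y q = e q" if "q \<in> E'" for q
      using y(2) that E'(1) N[OF \<alpha>(1) \<beta>] \<alpha>(2) iso(1)[of t q] fE[OF that] ft D that by auto
    then show ?thesis using y(1) by blast
  qed
qed


section \<open>Sets smaller than a regular cardinal\<close>

locale regular_cardinal =
  fixes \<kappa> :: "'k rel"
  assumes Card: "Card_order \<kappa>" and inf: "infinite (Field \<kappa>)" and reg: "regularCard \<kappa>"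
begin

abbreviation small :: "'x set \<Rightarrow> bool" where "small W \<equiv> |W| <o \<kappa>"

lemma WO: "Well_order \<kappa>"
  using Card by (simp add: card_order_on_well_order_on)

lemma not_small_iff: "\<not> small W \<longleftrightarrow> \<kappa> \<le>o |W|"
  using not_ordLess_iff_ordLeq[OF WO card_of_Well_order] by blast

lemma small_subset: "small V \<Longrightarrow> W \<subseteq> V \<Longrightarrow> small W"
  using card_of_mono1 ordLeq_ordLess_trans by blast

lemma small_le: "small V \<Longrightarrow> |W| \<le>o |V| \<Longrightarrow> small W"
  using ordLeq_ordLess_trans by blast

lemma small_Un: "small V \<Longrightarrow> small W \<Longrightarrow> small (V \<union> W)"
  by (rule card_of_Un_ordLess_infinite_Field[OF inf Card])

lemma small_finite: "finite W \<Longrightarrow> small W"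
  by (rule finite_ordLess_infinite[OF card_of_Well_order WO]) (use inf in \<open>auto simp: Field_card_of\<close>)

lemma small_image: "small W \<Longrightarrow> small (f ` W)"
  using small_le card_of_image by blast

lemma small_UN: "small I \<Longrightarrow> (\<And>i. i \<in> I \<Longrightarrow> small (W i)) \<Longrightarrow> small (\<Union>i\<in>I. W i)"
  by (rule stable_UNION[OF regularCard_stable[OF Card inf reg]])

lemma large_UN: "small I \<Longrightarrow> \<not> small (\<Union>i\<in>I. W i) \<Longrightarrow> \<exists>i\<in>I. \<not> small (W i)"
  using small_UN[of I W] by blast

lemma small_imp_le: "small W \<Longrightarrow> |W| \<le>o \<kappa>"
  by (rule ordLess_imp_ordLeq)

lemma le_UN: "|I| \<le>o \<kappa> \<Longrightarrow> (\<And>i. i \<in> I \<Longrightarrow> |W i| \<le>o \<kappa>) \<Longrightarrow> |\<Union>i\<in>I. W i| \<le>o \<kappa>"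
  by (rule card_of_UNION_ordLeq_infinite_Field[OF inf Card]) auto

lemma le_subset: "|V| \<le>o \<kappa> \<Longrightarrow> W \<subseteq> V \<Longrightarrow> |W| \<le>o \<kappa>"
  using card_of_mono1 ordLeq_transitive by blast

lemma large_two_points: "\<not> small W \<Longrightarrow> \<exists>a\<in>W. \<exists>b\<in>W. a \<noteq> b"
proof (rule ccontr)
  assume *: "\<not> small W" "\<not> (\<exists>a\<in>W. \<exists>b\<in>W. a \<noteq> b)"
  have "W \<subseteq> {SOME a. a \<in> W}"
  proof
    fix b assume "b \<in> W"
    then show "b \<in> {SOME a. a \<in> W}" using *(2) someI[of "\<lambda>a. a \<in> W" b] by blast
  qed
  then show False using *(1) small_finite finite_subset by blast
qed

lemma large_subset: "\<not> small W \<Longrightarrow> \<exists>V\<subseteq>W. |V| =o \<kappa>"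
proof -
  assume "\<not> small W"
  then have "|Field \<kappa>| \<le>o |W|"
    using not_small_iff card_of_Field_ordIso[OF Card] ordIso_ordLeq_trans by blast
  then obtain f where f: "inj_on f (Field \<kappa>)" "f ` Field \<kappa> \<subseteq> W"
    using card_of_ordLeq[of "Field \<kappa>" W] by blast
  have "|Field \<kappa>| =o |f ` Field \<kappa>|"
    using card_of_ordIsoI f(1) inj_on_imp_bij_betw by blast
  then have "|f ` Field \<kappa>| =o \<kappa>"
    using card_of_Field_ordIso[OF Card] ordIso_symmetric ordIso_transitive by blast
  then show ?thesis using f(2) by blast
qed

lemma eq_not_small: "|W| =o \<kappa> \<Longrightarrow> \<not> small W"
  using not_ordLess_ordIso ordIso_symmetric by blast

lemma greater_not_small: "\<kappa> <o |W| \<Longrightarrow> \<not> small W"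
  using not_ordLess_ordLeq ordLess_imp_ordLeq by blast

lemma greater_not_le: "\<kappa> <o |W| \<Longrightarrow> \<not> |W| \<le>o \<kappa>"
  using not_ordLess_ordLeq by blast

end

section \<open>Successors and limits in an infinite cardinal\<close>

locale limit_order =
  fixes r :: "'o rel"
  assumes Card_r: "Card_order r" and inf_r: "infinite (Field r)"
begin

abbreviation "s \<equiv> ord_succ r"

lemma WO_r: "Well_order r" 
  using Card_r by (simp add: card_order_on_well_order_on)

lemma wo: "wo_rel r"
  using WO_r by (rule wo_rel.intro)

lemma AboveS_ne: "i \<in> Field r \<Longrightarrow> AboveS r {i} \<noteq> {}"
  using infinite_Card_order_limit[OF Card_r inf_r, of i] unfolding AboveS_def by auto

lemma succ_Field: "i \<in> Field r \<Longrightarrow> s i \<in> Field r"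
  unfolding ord_succ_def by (rule wo_rel.suc_inField[OF wo]) (use AboveS_ne in auto)

lemma less_succ: "i \<in> Field r \<Longrightarrow> i \<in> underS r (s i)"
  unfolding ord_succ_def underS_def using wo_rel.suc_greater[OF wo, of "{i}" i] AboveS_ne by auto

lemma succ_least: "j \<in> underS r i \<Longrightarrow> (s j, i) \<in> r"
  unfolding ord_succ_def by (rule wo_rel.suc_least_AboveS[OF wo]) (auto simp: AboveS_def underS_def Field_def)

lemma underS_Field_r: "j \<in> underS r i \<Longrightarrow> j \<in> Field r \<and> i \<in> Field r \<and> (j, i) \<in> r"
  unfolding underS_def Field_def by auto

lemma le_or_less: "i \<in> Field r \<Longrightarrow> j \<in> Field r \<Longrightarrow> (i, j) \<in> r \<or> j \<in> underS r i"
  using wo_rel.TOTALS[OF wo] unfolding underS_def by blast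

lemma le_refl: "i \<in> Field r \<Longrightarrow> (i, i) \<in> r"
  using wo_rel.REFL[OF wo] unfolding refl_on_def by blast

lemma not_le_less: "(i, j) \<in> r \<Longrightarrow> j \<notin> underS r i"
  using wo_rel.ANTISYM[OF wo] unfolding underS_def antisym_def by blast

lemma le_less_trans: "(i, j) \<in> r \<Longrightarrow> j \<in> underS r k \<Longrightarrow> i \<in> underS r k"
  using wo_rel.TRANS[OF wo] wo_rel.ANTISYM[OF wo] unfolding underS_def trans_def antisym_def by blast

lemma le_iff: "(i, j) \<in> r \<Longrightarrow> i = j \<or> i \<in> underS r j"
  unfolding underS_def by blast

lemma less_succ_le: "i \<in> underS r (s j) \<Longrightarrow> j \<in> Field r \<Longrightarrow> (i, j) \<in> r"
  using le_or_less[of i j] succ_least[of j i] not_le_less underS_Field_r by blast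

lemma succ_mono: "(i, j) \<in> r \<Longrightarrow> (s i, s j) \<in> r"
  using succ_least[of i "s j"] le_less_trans less_succ by (meson FieldI2)

lemma zero_least: "i \<in> Field r \<Longrightarrow> (ord_zero r, i) \<in> r"
  unfolding ord_zero_def by (rule wo_rel.minim_least[OF wo]) auto

lemma zero_Field: "ord_zero r \<in> Field r"
  unfolding ord_zero_def by (rule wo_rel.minim_inField[OF wo]) (use inf_r in auto)

lemma ord_cases:
  assumes "i \<in> Field r"
  obtains "i = ord_zero r" | "ord_limit r i" | j where "j \<in> Field r" "i = s j"
  using assms unfolding ord_limit_def by blast

lemma ord_induct [consumes 1, case_names zero limit succ]:
  assumes "i \<in> Field r"
    and "P (ord_zero r)"
    and "\<And>i. ord_limit r i \<Longrightarrow> (\<And>j. j \<in> underS r i \<Longrightarrow> P j) \<Longrightarrow> P i"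
    and "\<And>j. j \<in> Field r \<Longrightarrow> (\<And>k. (k, j) \<in> r \<Longrightarrow> P k) \<Longrightarrow> P (s j)"
  shows "P i"
proof -
  have "i \<in> Field r \<longrightarrow> P i"
  proof (induction i rule: wf_induct_rule[OF wo_rel.WF[OF wo]])
    case (1 i)
    have IH: "P j" if "j \<in> underS r i" for j
      using 1 that underS_Field_r[OF that] unfolding underS_def by blast
    show ?case
    proof
      assume "i \<in> Field r"
      then show "P i"
      proof (cases i rule: ord_cases)
        case (3 j)
        have "P k" if "(k, j) \<in> r" for k using IH that le_less_trans less_succ 3 by blast
        then show ?thesis using assms(4) 3 by blast
      qed (use assms IH in auto)
    qed
  qed
  then show ?thesis using assms(1) by blast
qed

end


section \<open>The tower of spaces\<close>

text \<open>
  What the rest of the proof uses of the construction, with all distances measured in the union \<open>M\<close>: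
  \<open>B i\<close> is the set of points of the stage \<open>i\<close>, and \<open>A i\<close> and \<open>S i\<close> are those of the intermediate spaces
  \<open>B (s i) \<subseteq> A i \<subseteq> S i \<subseteq> B (s (s i))\<close> obtained by the operations A and S.  \<open>D i x\<close> is the set attached
  to a point \<open>x\<close> born at the stage \<open>s i\<close>.
\<close>

locale tower = regular_cardinal \<kappa> + limit_order "cardSuc \<kappa>"
  for \<kappa> :: "'k rel" +
  fixes M :: "'a metric" and B A S :: "'k set \<Rightarrow> 'a set" and D :: "'k set \<Rightarrow> 'a \<Rightarrow> 'a set"
  assumes stage_zero: "B (ord_zero (cardSuc \<kappa>)) = {}"
    and stage_one: "B (s (ord_zero (cardSuc \<kappa>))) \<noteq> {}"
    and stage_limit: "ord_limit (cardSuc \<kappa>) i \<Longrightarrow> B i = (\<Union>j\<in>underS (cardSuc \<kappa>) i. B j)"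
    and stage_limit_succ: "ord_limit (cardSuc \<kappa>) i \<Longrightarrow> B (s i) = B i"
    and union: "mspace M = (\<Union>i\<in>Field (cardSuc \<kappa>). B i)"
    and S_subset: "i \<in> Field (cardSuc \<kappa>) \<Longrightarrow> S i \<subseteq> B (s (s i))"
    and A_subset: "i \<in> Field (cardSuc \<kappa>) \<Longrightarrow> A i \<subseteq> S i"
    and A_eq: "i \<in> Field (cardSuc \<kappa>) \<Longrightarrow> A i = B (s i) \<union> (\<Union>x\<in>B (s i) - B i. D i x)"
    and D_new: "i \<in> Field (cardSuc \<kappa>) \<Longrightarrow> x \<in> B (s i) - B i \<Longrightarrow> D i x \<inter> B (s i) = {}"
    and D_unit: "i \<in> Field (cardSuc \<kappa>) \<Longrightarrow> x \<in> B (s i) - B i \<Longrightarrow> a \<in> D i x \<Longrightarrow> b \<in> D i x \<Longrightarrow> a \<noteq> b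
      \<Longrightarrow> mdist M a b = 1"
    and D_gate: "i \<in> Field (cardSuc \<kappa>) \<Longrightarrow> x \<in> B (s i) - B i \<Longrightarrow> a \<in> D i x \<Longrightarrow> b \<in> A i - D i x
      \<Longrightarrow> mdist M a b = 1 + mdist M x b"
    and D_large: "i \<in> Field (cardSuc \<kappa>) \<Longrightarrow> x \<in> B (s i) - B i \<Longrightarrow> \<kappa> <o |D i x|"
    and D_larger: "i \<in> Field (cardSuc \<kappa>) \<Longrightarrow> x \<in> B (s i) - B i \<Longrightarrow> |B (s i)| <o |D i x|"
    and D_disjoint: "i \<in> Field (cardSuc \<kappa>) \<Longrightarrow> x \<in> B (s i) - B i \<Longrightarrow> y \<in> B (s i) - B i \<Longrightarrow> x \<noteq> y
      \<Longrightarrow> D i x \<inter> D i y = {}"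
    and D_inj: "i \<in> Field (cardSuc \<kappa>) \<Longrightarrow> x \<in> B (s i) - B i \<Longrightarrow> y \<in> B (s i) - B i \<Longrightarrow> |D i x| =o |D i y|
      \<Longrightarrow> x = y"
    and S_new: "i \<in> Field (cardSuc \<kappa>) \<Longrightarrow> z \<in> S i - A i \<Longrightarrow> \<exists>Y\<subseteq>A i. |Y| =o \<kappa> \<and>
      (\<forall>y\<in>Y. \<forall>y'\<in>Y. y \<noteq> y' \<longrightarrow> mdist M y y' = 1) \<and>
      (\<forall>j x. (j, i) \<in> cardSuc \<kappa> \<longrightarrow> x \<in> B (s j) - B j \<longrightarrow> |Y \<inter> insert x (D j x)| <o \<kappa>) \<and>
      (\<forall>b\<in>S i - {z}. \<forall>\<epsilon>>0. \<exists>y\<in>Y. 1/2 + mdist M y b < mdist M z b + \<epsilon>)"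
    and S_middle: "i \<in> Field (cardSuc \<kappa>) \<Longrightarrow> Y \<subseteq> A i \<Longrightarrow> |Y| =o \<kappa> \<Longrightarrow>
      \<forall>y\<in>Y. \<forall>y'\<in>Y. y \<noteq> y' \<longrightarrow> mdist M y y' = 1 \<Longrightarrow>
      hereditarily_without_middle_points \<kappa> M Y \<Longrightarrow>
      \<forall>j x. (j, i) \<in> cardSuc \<kappa> \<longrightarrow> x \<in> B (s j) - B j \<longrightarrow> |Y \<inter> insert x (D j x)| <o \<kappa> \<Longrightarrow>
      \<exists>z\<in>S i. \<forall>y\<in>Y. mdist M z y = 1/2"
    and F_new: "i \<in> Field (cardSuc \<kappa>) \<Longrightarrow> p \<in> B (s (s i)) - S i \<Longrightarrow> \<exists>E\<subseteq>S i. |E| <o \<kappa> \<and>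
      (\<forall>b\<in>S i. \<forall>\<epsilon>>0. \<exists>q\<in>E. mdist M p q + mdist M q b < mdist M p b + \<epsilon>)"
    and F_realizes: "i \<in> Field (cardSuc \<kappa>) \<Longrightarrow> E \<subseteq> S i \<Longrightarrow> |E| <o \<kappa> \<Longrightarrow> E \<noteq> {} \<Longrightarrow> \<forall>q\<in>E. 0 < e q \<Longrightarrow>
      \<forall>q\<in>E. \<forall>q'\<in>E. e q \<le> mdist M q q' + e q' \<and> mdist M q q' \<le> e q + e q' \<Longrightarrow>
      \<exists>p\<in>B (s (s i)). \<forall>q\<in>E. mdist M p q = e q"
begin

abbreviation "r \<equiv> cardSuc \<kappa>"
abbreviation "d \<equiv> mdist M"

abbreviation separated :: "'a set \<Rightarrow> bool" where
  "separated W \<equiv> \<forall>a\<in>W. \<forall>b\<in>W. a \<noteq> b \<longrightarrow> d a b = 1"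

lemma B_A: "i \<in> Field r \<Longrightarrow> B (s i) \<subseteq> A i"
  using A_eq by blast

lemma D_A: "i \<in> Field r \<Longrightarrow> x \<in> B (s i) - B i \<Longrightarrow> D i x \<subseteq> A i"
  using A_eq by blast

lemma A_B: "i \<in> Field r \<Longrightarrow> A i \<subseteq> B (s (s i))"
  using S_subset A_subset by blast

lemma B_step: "i \<in> Field r \<Longrightarrow> B i \<subseteq> B (s i)"
  by (cases i rule: ord_cases) (use stage_zero stage_limit_succ B_A A_B in blast)+

lemma B_mono: "(i, j) \<in> r \<Longrightarrow> B i \<subseteq> B j"
proof -
  have "j \<in> Field r \<Longrightarrow> (i, j) \<in> r \<longrightarrow> B i \<subseteq> B j" for j
  proof (induction j rule: ord_induct)
    case zero
    then show ?case using zero_least[of i] not_le_less le_iff FieldI1[of i] by blast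
  next
    case (limit j)
    then show ?case using stage_limit le_iff by blast
  next
    case (succ j)
    show ?case
    proof
      assume "(i, s j) \<in> r"
      then have "i = s j \<or> (i, j) \<in> r" using le_iff less_succ_le succ by blast
      then show "B i \<subseteq> B (s j)" 
        using succ.IH[OF le_refl[OF succ.hyps]] B_step[OF succ.hyps] by blast
    qed
  qed
  then show "(i, j) \<in> r \<Longrightarrow> B i \<subseteq> B j" by (blast intro: FieldI2)
qed

lemma B_space: "i \<in> Field r \<Longrightarrow> B i \<subseteq> mspace M"
  using union by blast

lemma A_space: "i \<in> Field r \<Longrightarrow> A i \<subseteq> mspace M"
  using B_space A_B succ_Field by blast

lemma S_space: "i \<in> Field r \<Longrightarrow> S i \<subseteq> mspace M"
  using B_space S_subset succ_Field by blast

text \<open>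
  The first stage that contains \<open>x\<close> is neither zero nor a limit.
\<close>

lemma birth:
  assumes "x \<in> mspace M" obtains i where "i \<in> Field r" "x \<in> B (s i) - B i"
proof -
  obtain k where k: "k \<in> Field r" "x \<in> B k" using assms union by blast
  have "\<exists>i\<in>Field r. x \<in> B (s i) - B i"
    using k
  proof (induction k rule: ord_induct)
    case zero
    then show ?case using stage_zero by simp
  next
    case (limit k)
    then show ?case using stage_limit by blast
  next
    case (succ k)
    show ?case
    proof (cases "x \<in> B k")
      case True
      have "(k, k) \<in> r" using le_refl succ.hyps by blast
      then show ?thesis using succ.IH True by blast
    next
      case False
      then show ?thesis using succ by blast
    qed
  qed
  then show thesis using that by blast
qed

lemma S_subset_later_B: "i \<in> underS r j \<Longrightarrow> S i \<subseteq> B (s j)"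
  using S_subset underS_Field_r[of i j] B_mono[OF succ_mono[OF succ_least]] by blast

text \<open>
  To prove a property of all points it suffices to start at the space \<open>A i\<close> and to follow the three
  kinds of new points through the later stages.
\<close>

lemma stage_induct:
  assumes i: "i \<in> Field r"
    and base: "\<And>p. p \<in> A i \<Longrightarrow> P p"
    and attached: "\<And>j p. i \<in> underS r j \<Longrightarrow> (\<And>q. q \<in> B (s j) \<Longrightarrow> P q) \<Longrightarrow> p \<in> A j - B (s j) \<Longrightarrow> P p"
    and middle: "\<And>j p. (i, j) \<in> r \<Longrightarrow> (\<And>q. q \<in> A j \<Longrightarrow> P q) \<Longrightarrow> p \<in> S j - A j \<Longrightarrow> P p"
    and extension: "\<And>j p. (i, j) \<in> r \<Longrightarrow> (\<And>q. q \<in> S j \<Longrightarrow> P q) \<Longrightarrow> p \<in> B (s (s j)) - S j \<Longrightarrow> P p"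
    and p: "p \<in> mspace M"
  shows "P p"
proof -
  have "\<forall>p\<in>B k. P p" if "k \<in> Field r" for k
    using that
  proof (induction k rule: ord_induct)
    case zero
    then show ?case using stage_zero by simp
  next
    case (limit k)
    then show ?case using stage_limit by blast
  next
    case (succ m)
    have early: "\<forall>p\<in>B (s m). P p" if "(m, i) \<in> r"
      using base B_mono[OF succ_mono[OF that]] B_A[OF i] by blast
    from succ.hyps show ?case
    proof (cases m rule: ord_cases)
      case 1
      then show ?thesis using early zero_least[OF i] by blast
    next
      case 2
      have "(m, m) \<in> r" using le_refl succ.hyps by blast
      then show ?thesis using succ.IH stage_limit_succ[OF 2] by simp
    next
      case (3 j)
      show ?thesis
      proof (cases "j \<in> underS r i")
        case True
        then show ?thesis using early succ_least 3 by blast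
      next
        case False
        then have ij: "(i, j) \<in> r" using le_or_less i 3 by blast
        have mm: "(s j, m) \<in> r" using le_refl succ.hyps 3 by blast
        have "P q" if q: "q \<in> A j" for q
        proof (cases "i = j")
          case False
          then have "i \<in> underS r j" using ij le_iff by blast
          moreover have "\<forall>q\<in>B (s j). P q" using succ.IH mm by blast
          ultimately show ?thesis using attached[of j q] q by blast
        qed (use base q in blast)
        then have "P q" if "q \<in> S j" for q using middle[OF ij] that by blast
        then have "P q" if "q \<in> B (s (s j))" for q using extension[OF ij] that by blast
        then show ?thesis using 3 by blast
      qed
    qed
  qed
  then show ?thesis using p union by blast
qed

text \<open>
  As \<open>\<kappa>\<^sup>+\<close> is regular, every set of at most \<open>\<kappa>\<close> points is contained in some stage.
\<close>

lemma captured: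
  assumes "W \<subseteq> mspace M" "|W| \<le>o \<kappa>" obtains i where "i \<in> Field r" "W \<subseteq> B (s i)"
proof -
  have "\<exists>i\<in>Field r. W \<subseteq> B i"
    by (rule cardSuc_UNION[OF Card inf]) (use assms union B_mono in \<open>auto simp: relChain_def\<close>)
  then show thesis using that B_step by blast
qed

end


section \<open>Distances to an attached set\<close>

context tower
begin

lemma new_middle_point:
  assumes "j \<in> Field r" "z \<in> S j - A j"
  obtains Y where "Y \<subseteq> A j" "|Y| =o \<kappa>" "separated Y"
    "\<forall>i x. (i, j) \<in> r \<longrightarrow> x \<in> B (s i) - B i \<longrightarrow> small (Y \<inter> insert x (D i x))"
    "\<forall>b \<epsilon>. b \<in> S j \<longrightarrow> b \<noteq> z \<longrightarrow> \<epsilon> > 0 \<longrightarrow> (\<exists>y\<in>Y. 1/2 + d y b < d z b + \<epsilon>)"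
proof -
  obtain Y where Y: "Y \<subseteq> A j" "|Y| =o \<kappa>" "separated Y"
    and small: "\<forall>i x. (i, j) \<in> r \<longrightarrow> x \<in> B (s i) - B i \<longrightarrow> small (Y \<inter> insert x (D i x))"
    and gate: "\<forall>b\<in>S j - {z}. \<forall>\<epsilon>>0. \<exists>y\<in>Y. 1/2 + d y b < d z b + \<epsilon>"
    using S_new[OF assms] by (elim exE conjE) (rule that)
  show thesis
    by (rule that[OF Y]) (use small gate in simp_all)
qed

lemma new_extension_point:
  assumes "j \<in> Field r" "p \<in> B (s (s j)) - S j"
  obtains E where "E \<subseteq> S j" "small E"
    "\<forall>b \<epsilon>. b \<in> S j \<longrightarrow> \<epsilon> > 0 \<longrightarrow> (\<exists>q\<in>E. d p q + d q b < d p b + \<epsilon>)"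
proof -
  obtain E where E: "E \<subseteq> S j" "small E"
    and gate: "\<forall>b\<in>S j. \<forall>\<epsilon>>0. \<exists>q\<in>E. d p q + d q b < d p b + \<epsilon>"
    using F_new[OF assms] by (elim exE conjE) (rule that)
  show thesis
    by (rule that[OF E]) (use gate in simp)
qed

lemma attached_later_far:
  assumes "i \<in> underS r j" "p \<in> A j - B (s j)"
  obtains y where "y \<in> B (s j)" "\<And>q. q \<in> B (s j) \<Longrightarrow> d p q = 1 + d y q"
proof -
  have j: "j \<in> Field r" using assms(1) underS_Field_r by blast
  then obtain y where y: "y \<in> B (s j) - B j" "p \<in> D j y" using A_eq assms(2) by blast
  have "d p q = 1 + d y q" if "q \<in> B (s j)" for q
    by (rule D_gate[OF j y]) (use that D_new[OF j y(1)] B_A[OF j] in blast)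
  then show thesis using that y by blast
qed

lemma attached_dichotomy:
  assumes i: "i \<in> Field r" and x: "x \<in> B (s i) - B i" and p: "p \<in> A i" and a: "a \<in> D i x" and "p \<noteq> a"
  shows "p \<in> D i x \<and> d p a = 1 \<or> p \<notin> D i x \<and> d p a = 1 + d p x"
  using D_unit[OF i x _ a, of p] D_gate[OF i x a, of p] assms mdist_commute[of M] by (metis DiffI)

text \<open>
  The distance from \<open>p\<close> to most points of \<open>D i x\<close> is at least one plus the distance from \<open>p\<close> to
  \<open>D i x \<union> {x}\<close>, the latter cut off at \<open>1/2\<close>.  Writing this with a lower bound \<open>t\<close> of arbitrary sign
  makes it hereditary: if \<open>t\<close> is admissible for \<open>p\<close>, then \<open>t - d p q\<close> is admissible for \<open>q\<close>.  So a bad point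
  for a new point is bad for one of the points that determine its distances, and there are at most \<open>\<kappa>\<close>
  of these.
\<close>

lemma few_close_points:
  assumes i: "i \<in> Field r" and x: "x \<in> B (s i) - B i" and p: "p \<in> mspace M"
  shows "\<forall>t\<le>1/2. (\<forall>c\<in>insert x (D i x). t \<le> d p c) \<longrightarrow> |{a \<in> D i x. d p a < 1 + t}| \<le>o \<kappa>"
proof -
  define P where "P p \<longleftrightarrow> (\<forall>t\<le>1/2. (\<forall>c\<in>insert x (D i x). t \<le> d p c) \<longrightarrow> |{a \<in> D i x. d p a < 1 + t}| \<le>o \<kappa>)" for p
  have P0: "|{a \<in> D i x. d q a < 1}| \<le>o \<kappa>" if "P q" for q
    using that[unfolded P_def, rule_format, of 0] by simp
  have D: "D i x \<subseteq> A i" by (rule D_A[OF i x])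
  have small_P: "|{a \<in> D i x. d p a < 1 + t}| \<le>o \<kappa>" if "{a \<in> D i x. d p a < 1 + t} \<subseteq> {p}" for p t
    using small_imp_le[OF small_finite] finite_subset[OF that] by blast
  have "P p"
  proof (induct p rule: stage_induct[OF i])
    case (1 p)
    have "{a \<in> D i x. d p a < 1 + t} \<subseteq> {p}" if t: "\<forall>c\<in>insert x (D i x). t \<le> d p c" for t
    proof
      fix a assume a: "a \<in> {a \<in> D i x. d p a < 1 + t}"
      show "a \<in> {p}"
      proof (rule ccontr)
        assume "a \<notin> {p}"
        then consider "p \<in> D i x" "d p a = 1" | "d p a = 1 + d p x"
          using attached_dichotomy[OF i x 1, of a] a by blast
        then show False
        proof cases
          case 1
          then have "t \<le> d p p" using t by blast
          moreover have "d p p = 0" using D A_space[OF i] 1 by auto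
          ultimately show False using 1 a by simp
        qed (use t a in auto)
      qed
    qed
    then show ?case unfolding P_def using small_P by blast
  next
    case (2 j p)
    obtain y where y: "y \<in> B (s j)" "\<And>q. q \<in> B (s j) \<Longrightarrow> d p q = 1 + d y q"
      using attached_later_far 2 by blast
    have "D i x \<subseteq> B (s j)"
      using D A_subset[OF i] S_subset_later_B[OF 2(1)] by blast
    then have "{a \<in> D i x. d p a < 1 + t} \<subseteq> {a \<in> D i x. d y a < 1}" if "t \<le> 1/2" for t
      using y(2) that by fastforce
    then show ?case unfolding P_def using le_subset[OF P0[OF 2(2)[OF y(1)]]] by blast
  next
    case (3 j p)
    have j: "j \<in> Field r" using 3(1) by (rule FieldI2)
    obtain Y where Y: "Y \<subseteq> A j" "|Y| =o \<kappa>" "separated Y"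
      "\<forall>i x. (i, j) \<in> r \<longrightarrow> x \<in> B (s i) - B i \<longrightarrow> small (Y \<inter> insert x (D i x))"
      "\<forall>b \<epsilon>. b \<in> S j \<longrightarrow> b \<noteq> p \<longrightarrow> \<epsilon> > 0 \<longrightarrow> (\<exists>y\<in>Y. 1/2 + d y b < d p b + \<epsilon>)"
    by (rule new_middle_point[OF j 3(3)])
    have DA: "D i x \<subseteq> A j"
      using D le_iff[OF 3(1)] S_subset_later_B A_subset[OF i] B_A[OF j] by blast
    have "{a \<in> D i x. d p a < 1 + t} \<subseteq> (\<Union>y\<in>Y. {a \<in> D i x. d y a < 1})" if "t \<le> 1/2" for t
    proof
      fix a assume a: "a \<in> {a \<in> D i x. d p a < 1 + t}"
      then have "a \<in> S j" "a \<noteq> p" using DA A_subset[OF j] 3(3) by auto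
      moreover have "0 < 1 + t - d p a" using a by simp
      ultimately obtain y where "y \<in> Y" "1/2 + d y a < d p a + (1 + t - d p a)" using Y(5) by blast
      moreover from this have "d y a < 1" using that by linarith
      ultimately show "a \<in> (\<Union>y\<in>Y. {a \<in> D i x. d y a < 1})" using a by blast
    qed
    moreover have "|\<Union>y\<in>Y. {a \<in> D i x. d y a < 1}| \<le>o \<kappa>"
      by (rule le_UN[OF ordIso_imp_ordLeq[OF Y(2)]], rule P0, rule 3(2)) (use Y(1) in blast)
    ultimately show ?case unfolding P_def using le_subset by blast
  next
    case (4 j p)
    have j: "j \<in> Field r" using 4(1) by (rule FieldI2)
    obtain E where E: "E \<subseteq> S j" "small E"
      "\<forall>b \<epsilon>. b \<in> S j \<longrightarrow> \<epsilon> > 0 \<longrightarrow> (\<exists>q\<in>E. d p q + d q b < d p b + \<epsilon>)"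
      by (rule new_extension_point[OF j 4(3)])
    have DS: "D i x \<subseteq> S j" "x \<in> S j"
      using D x le_iff[OF 4(1)] S_subset_later_B A_subset[OF i] B_A[OF j] B_A[OF i] A_subset[OF j] by blast+
    have pM: "p \<in> mspace M" using 4(3) B_space[OF succ_Field[OF succ_Field[OF j]]] by blast
    show ?case unfolding P_def
    proof (intro allI impI)
      fix t :: real assume t: "t \<le> 1/2" "\<forall>c\<in>insert x (D i x). t \<le> d p c"
      have "{a \<in> D i x. d p a < 1 + t} \<subseteq> (\<Union>q\<in>E. {a \<in> D i x. d q a < 1 + (t - d p q)})"
      proof
        fix a assume a: "a \<in> {a \<in> D i x. d p a < 1 + t}"
        then have "0 < 1 + t - d p a" "a \<in> S j" using DS by auto
        then obtain q where "q \<in> E" "d p q + d q a < d p a + (1 + t - d p a)" using E(3) by blast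
        moreover from this have "d q a < 1 + (t - d p q)" by linarith
        ultimately show "a \<in> (\<Union>q\<in>E. {a \<in> D i x. d q a < 1 + (t - d p q)})" using a by blast
      qed
      moreover have "|\<Union>q\<in>E. {a \<in> D i x. d q a < 1 + (t - d p q)}| \<le>o \<kappa>"
      proof (rule le_UN)
        show "|E| \<le>o \<kappa>" using E(2) by (rule small_imp_le)
        fix q assume q: "q \<in> E"
        have qM: "q \<in> mspace M" using q E(1) S_space[OF j] by blast
        have "t - d p q \<le> 1/2" using t(1) mdist_nonneg[of M p q] by linarith
        moreover have "t - d p q \<le> d q c" if c: "c \<in> insert x (D i x)" for c
        proof -
          have "c \<in> mspace M" using c DS S_space[OF j] by blast
          then have "d p c \<le> d p q + d q c" by (rule mdist_triangle[OF pM qM])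
          moreover have "t \<le> d p c" using t(2) c by blast
          ultimately show ?thesis by linarith
        qed
        ultimately show "|{a \<in> D i x. d q a < 1 + (t - d p q)}| \<le>o \<kappa>"
          using 4(2)[of q] q E(1) unfolding P_def by blast
      qed
      ultimately show "|{a \<in> D i x. d p a < 1 + t}| \<le>o \<kappa>" using le_subset by blast
    qed
  qed (rule p)
  then show ?thesis unfolding P_def .
qed

lemma separated_D: "i \<in> Field r \<Longrightarrow> x \<in> B (s i) - B i \<Longrightarrow> separated (D i x)"
  using D_unit by blast

text \<open>
  Every path that leaves \<open>z\<close> starts with an edge of length \<open>1/2\<close>.
\<close>

lemma middle_points_far:
  assumes j: "j \<in> Field r" and z: "z \<in> S j - A j" and b: "b \<in> S j" "b \<noteq> z"
  shows "1/2 \<le> d z b"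
proof (rule field_le_epsilon)
  fix e :: real assume e: "e > 0"
  obtain Y where Y: "Y \<subseteq> A j" "|Y| =o \<kappa>" "separated Y"
      "\<forall>i x. (i, j) \<in> r \<longrightarrow> x \<in> B (s i) - B i \<longrightarrow> small (Y \<inter> insert x (D i x))"
      "\<forall>b \<epsilon>. b \<in> S j \<longrightarrow> b \<noteq> z \<longrightarrow> \<epsilon> > 0 \<longrightarrow> (\<exists>y\<in>Y. 1/2 + d y b < d z b + \<epsilon>)"
    by (rule new_middle_point[OF j z])
  obtain y where "1/2 + d y b < d z b + e" using Y(5)[rule_format, OF b e] by blast
  then show "1/2 \<le> d z b + e" using mdist_nonneg[of M y b] by linarith
qed

lemma distinct_middle_points_far:
  assumes j: "j \<in> Field r" and z: "z \<in> S j - A j" and j': "j' \<in> Field r" and z': "z' \<in> S j' - A j'"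
    and ne: "z \<noteq> z'"
  shows "1/2 \<le> d z z'"
proof -
  consider "j = j'" | "j \<in> underS r j'" | "j' \<in> underS r j"
    using le_or_less[OF j j'] le_iff by blast
  then show ?thesis
  proof cases
    case 1
    then show ?thesis using middle_points_far[OF j z, of z'] z' ne by blast
  next
    case 2
    then have "z \<in> S j'" using S_subset_later_B[OF 2] B_A[OF j'] A_subset[OF j'] z by blast
    then show ?thesis using middle_points_far[OF j' z', of z] ne by (simp add: mdist_commute)
  next
    case 3
    then have "z' \<in> S j" using S_subset_later_B[OF 3] B_A[OF j] A_subset[OF j] z' by blast
    then show ?thesis using middle_points_far[OF j z, of z'] ne by simp
  qed
qed

text \<open>
  No point of \<open>A i\<close> and no point attached later is closer than one to a point of \<open>D i x\<close> other than itself.  So a point that is closer than one to \<open>\<kappa>\<close> points of \<open>D i x\<close> owes this to the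
  operation S: tracing the distances of points added by F back through fewer than \<open>\<kappa>\<close> points, regularity of
  \<open>\<kappa>\<close> always leaves one of them that is still close to \<open>\<kappa>\<close> points, until a point added by S is reached.
\<close>

lemma close_to_many_via_middle_point:
  assumes i: "i \<in> Field r" and x: "x \<in> B (s i) - B i" and p: "p \<in> mspace M"
  shows "\<forall>u\<le>1. \<not> small {a \<in> D i x. d p a < u} \<longrightarrow>
    (\<exists>j z. (i, j) \<in> r \<and> z \<in> S j - A j \<and> \<not> small {a \<in> D i x. d z a < u - d p z})"
proof -
  define P where "P p \<longleftrightarrow> (\<forall>u\<le>1. \<not> small {a \<in> D i x. d p a < u} \<longrightarrow>
    (\<exists>j z. (i, j) \<in> r \<and> z \<in> S j - A j \<and> \<not> small {a \<in> D i x. d z a < u - d p z}))" for p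
  have D: "D i x \<subseteq> A i" by (rule D_A[OF i x])
  have "P p"
  proof (induct p rule: stage_induct[OF i])
    case (1 p)
    have "1 \<le> d p a" if "a \<in> D i x" "a \<noteq> p" for a
      using attached_dichotomy[OF i x 1, of a] that mdist_nonneg[of M p x] by auto
    then have "{a \<in> D i x. d p a < u} \<subseteq> {p}" if "u \<le> 1" for u
      using that by fastforce
    then have "small {a \<in> D i x. d p a < u}" if "u \<le> 1" for u
      using that small_finite finite_subset by blast
    then show ?case unfolding P_def by blast
  next
    case (2 j p)
    obtain y where y: "\<And>q. q \<in> B (s j) \<Longrightarrow> d p q = 1 + d y q"
      using attached_later_far 2 by blast
    have "D i x \<subseteq> B (s j)"
      using D A_subset[OF i] S_subset_later_B[OF 2(1)] by blast
    then have "1 \<le> d p a" if "a \<in> D i x" for a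
      using y[of a] that mdist_nonneg[of M y a] by auto
    then have "{a \<in> D i x. d p a < u} \<subseteq> {}" if "u \<le> 1" for u
      using that by fastforce
    then have "small {a \<in> D i x. d p a < u}" if "u \<le> 1" for u
      using that small_finite finite_subset by blast
    then show ?case unfolding P_def by blast
  next
    case (3 j p)
    have "d p p = 0" using 3(3) S_space[OF FieldI2[OF 3(1)]] by auto
    then show ?case unfolding P_def using 3(1,3)
      by (intro allI impI exI[of _ j] exI[of _ p]) simp
  next
    case (4 j p)
    have j: "j \<in> Field r" using 4(1) by (rule FieldI2)
    obtain E where E: "E \<subseteq> S j" "small E"
      "\<forall>b \<epsilon>. b \<in> S j \<longrightarrow> \<epsilon> > 0 \<longrightarrow> (\<exists>q\<in>E. d p q + d q b < d p b + \<epsilon>)"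
      by (rule new_extension_point[OF j 4(3)])
    have DS: "D i x \<subseteq> S j"
      using D le_iff[OF 4(1)] S_subset_later_B A_subset[OF i] B_A[OF j] A_subset[OF j] by blast
    have pM: "p \<in> mspace M" using 4(3) B_space[OF succ_Field[OF succ_Field[OF j]]] by blast
    show ?case unfolding P_def
    proof (intro allI impI)
      fix u :: real assume u: "u \<le> 1" "\<not> small {a \<in> D i x. d p a < u}"
      have "{a \<in> D i x. d p a < u} \<subseteq> (\<Union>q\<in>E. {a \<in> D i x. d q a < u - d p q})"
      proof
        fix a assume a: "a \<in> {a \<in> D i x. d p a < u}"
        then have "0 < u - d p a" "a \<in> S j" using DS by auto
        then obtain q where "q \<in> E" "d p q + d q a < d p a + (u - d p a)" using E(3) by blast
        moreover from this have "d q a < u - d p q" by linarith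
        ultimately show "a \<in> (\<Union>q\<in>E. {a \<in> D i x. d q a < u - d p q})" using a by blast
      qed
      then have "\<not> small (\<Union>q\<in>E. {a \<in> D i x. d q a < u - d p q})" using u(2) small_subset by blast
      then obtain q where q: "q \<in> E" "\<not> small {a \<in> D i x. d q a < u - d p q}"
        using large_UN[OF E(2), of "\<lambda>q. {a \<in> D i x. d q a < u - d p q}"] by blast
      have "u - d p q \<le> 1" using u(1) mdist_nonneg[of M p q] by linarith
      then obtain k z where z: "(i, k) \<in> r" "z \<in> S k - A k" "\<not> small {a \<in> D i x. d z a < u - d p q - d q z}"
        using 4(2)[of q] q E(1) unfolding P_def by blast
      have "q \<in> mspace M" "z \<in> mspace M"
        using q E(1) S_space[OF j] z S_space[OF FieldI2[OF z(1)]] by blast+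
      then have "d p z \<le> d p q + d q z" by (rule mdist_triangle[OF pM])
      then have "{a \<in> D i x. d z a < u - d p q - d q z} \<subseteq> {a \<in> D i x. d z a < u - d p z}" by auto
      then have "\<not> small {a \<in> D i x. d z a < u - d p z}" using z(3) small_subset by blast
      then show "\<exists>j z. (i, j) \<in> r \<and> z \<in> S j - A j \<and> \<not> small {a \<in> D i x. d z a < u - d p z}"
        using z(1,2) by (intro exI[of _ k] exI[of _ z]) simp
    qed
  qed (rule p)
  then show ?thesis unfolding P_def .
qed

text \<open>
  Suppose that \<open>p\<close> is a middle point of a set \<open>Z\<close> of \<open>\<kappa>\<close> points of \<open>D i x\<close>.  Then there are points added by S
  arbitrarily close to \<open>p\<close>; being \<open>1/2\<close> apart, they all coincide with \<open>p\<close>.  So \<open>p\<close> was added by S as the middle point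
  of some \<open>Y\<close>.  A point at distance exactly \<open>1/2\<close> from it is a limit of points of \<open>Y\<close> and hence in \<open>Y\<close>, so
  that \<open>Z \<subseteq> Y\<close>, although \<open>Y\<close> meets \<open>D i x\<close> in fewer than \<open>\<kappa>\<close> points.
\<close>

lemma attached_without_middle_points:
  assumes i: "i \<in> Field r" and x: "x \<in> B (s i) - B i"
  shows "hereditarily_without_middle_points \<kappa> M (D i x)"
  unfolding hereditarily_without_middle_points_def
proof
  assume "\<exists>Z. Z \<subseteq> D i x \<and> |Z| =o \<kappa> \<and> (\<exists>p. middle_point M Z p)"
  then obtain Z p where Z: "Z \<subseteq> D i x" "|Z| =o \<kappa>" and p: "p \<in> mspace M" "\<forall>a\<in>Z. d p a = 1/2"
    unfolding middle_point_def by blast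
  have D: "D i x \<subseteq> A i" by (rule D_A[OF i x])
  have near: "\<exists>j z. (i, j) \<in> r \<and> z \<in> S j - A j \<and> d p z < u - 1/2" if u: "1/2 < u" "u \<le> 1" for u
  proof -
    have "Z \<subseteq> {a \<in> D i x. d p a < u}" using Z(1) p(2) u by auto
    then have "\<not> small {a \<in> D i x. d p a < u}" using eq_not_small[OF Z(2)] small_subset by blast
    then obtain j z where z: "(i, j) \<in> r" "z \<in> S j - A j" "\<not> small {a \<in> D i x. d z a < u - d p z}"
      using close_to_many_via_middle_point[OF i x p(1)] u by blast
    obtain a b where ab: "a \<in> D i x" "b \<in> D i x" "d z a < u - d p z" "d z b < u - d p z" "a \<noteq> b"
      using large_two_points[OF z(3)] by blast
    \<comment> \<open>Two points at distance one cannot both be closer than \<open>1/2\<close> to \<open>z\<close>.\<close>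
    have "a \<in> mspace M" "b \<in> mspace M" "z \<in> mspace M"
      using ab D A_space[OF i] z(2) S_space[OF FieldI2[OF z(1)]] by blast+
    then have "d a b \<le> d z a + d z b" using mdist_triangle[of a M z b] by (simp add: mdist_commute)
    moreover have "d a b = 1" using D_unit[OF i x ab(1,2,5)] .
    ultimately show ?thesis using ab z by (intro exI[of _ j] exI[of _ z]) auto
  qed
  obtain j z where z: "(i, j) \<in> r" "z \<in> S j - A j" "d p z < 1/4" using near[of "3/4"] by auto
  have j: "j \<in> Field r" using z(1) by (rule FieldI2)
  have zM: "z \<in> mspace M" using z S_space[OF j] by blast
  have "p = z"
  proof (rule ccontr)
    assume "p \<noteq> z"
    then have pos: "0 < d p z" using p(1) zM by (metis mdist_nonneg mdist_zero order_le_less)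
    then obtain j' z' where z': "(i, j') \<in> r" "z' \<in> S j' - A j'" "d p z' < d p z"
      using near[of "1/2 + d p z"] z(3) by auto
    then have "1/2 \<le> d z z'"
      using distinct_middle_points_far[OF j z(2) FieldI2[OF z'(1)] z'(2)] by auto
    moreover have "d z z' \<le> d p z + d p z'"
      using mdist_triangle[of z M p z'] zM p(1) z' S_space[OF FieldI2[OF z'(1)]] by (auto simp: mdist_commute)
    ultimately show False using z z' by linarith
  qed
  obtain Y where Y: "Y \<subseteq> A j" "|Y| =o \<kappa>" "separated Y"
      "\<forall>i x. (i, j) \<in> r \<longrightarrow> x \<in> B (s i) - B i \<longrightarrow> small (Y \<inter> insert x (D i x))"
      "\<forall>b \<epsilon>. b \<in> S j \<longrightarrow> b \<noteq> z \<longrightarrow> \<epsilon> > 0 \<longrightarrow> (\<exists>y\<in>Y. 1/2 + d y b < d z b + \<epsilon>)"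
    by (rule new_middle_point[OF j z(2)])
  have "D i x \<subseteq> A j"
    using D le_iff[OF z(1)] S_subset_later_B A_subset[OF i] B_A[OF j] by blast
  have "Z \<subseteq> Y \<inter> insert x (D i x)"
  proof
    fix a assume a: "a \<in> Z"
    have aS: "a \<in> A j" "a \<in> S j" "a \<noteq> z" using a Z(1) \<open>D i x \<subseteq> A j\<close> A_subset[OF j] z(2) by blast+
    have close: "\<exists>y\<in>Y. d y a < e" if e: "e > 0" for e
    proof -
      obtain y where "y \<in> Y" "1/2 + d y a < d z a + e"
        using Y(5)[rule_format, OF aS(2,3) e] by blast
      moreover have "d z a = 1/2" using p(2) a \<open>p = z\<close> by blast
      ultimately show ?thesis by (intro bexI[of _ y]) auto
    qed
    obtain y where y: "y \<in> Y" "d y a < 1/2" using close[of "1/2"] by auto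
    have M: "a \<in> mspace M" "\<And>y. y \<in> Y \<Longrightarrow> y \<in> mspace M" using aS Y(1) A_space[OF j] by blast+
    have "y = a"
    proof (rule ccontr)
      assume "y \<noteq> a"
      then have "0 < d y a" using M y(1) by (metis mdist_nonneg mdist_zero order_le_less)
      then obtain y' where y': "y' \<in> Y" "d y' a < d y a" using close by blast
      have "d y y' \<le> d y a + d y' a" using mdist_triangle[of y M a y'] M y y' by (simp add: mdist_commute)
      moreover have "d y y' = 1" using Y(3) y y' by auto
      ultimately show False using y y' by linarith
    qed
    then show "a \<in> Y \<inter> insert x (D i x)" using y a Z(1) by blast
  qed
  then show False using small_subset[OF Y(4)[rule_format, OF z(1) x]] eq_not_small[OF Z(2)] by blast
qed

end


section \<open>Rigidity\<close>

lemma isometry_ontoD: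
  assumes f: "isometry_onto M N f"
  shows "f ` mspace M = mspace N"
    and "\<And>x y. x \<in> mspace M \<Longrightarrow> y \<in> mspace M \<Longrightarrow> mdist N (f x) (f y) = mdist M x y"
    and "inj_on f (mspace M)"
proof -
  show "f ` mspace M = mspace N" using f unfolding isometry_onto_def by blast
  show dist: "mdist N (f x) (f y) = mdist M x y" if "x \<in> mspace M" "y \<in> mspace M" for x y
    using f that unfolding isometry_onto_def isometric_embedding_def by blast
  show "inj_on f (mspace M)"
  proof (rule inj_onI)
    fix x y assume xy: "x \<in> mspace M" "y \<in> mspace M" "f x = f y"
    then have "f y \<in> mspace N" using f unfolding isometry_onto_def by blast
    then show "x = y" using xy dist[of x y] by simp
  qed
qed

context tower
begin

abbreviation born :: "'k set \<Rightarrow> 'a \<Rightarrow> bool" where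
  "born i x \<equiv> i \<in> Field r \<and> x \<in> B (s i) - B i"

lemma without_middle_points_subset:
  "hereditarily_without_middle_points \<kappa> M W \<Longrightarrow> V \<subseteq> W \<Longrightarrow> hereditarily_without_middle_points \<kappa> M V"
  unfolding hereditarily_without_middle_points_def by blast

lemma D_space: "born i x \<Longrightarrow> D i x \<subseteq> mspace M"
  using D_A A_space by blast

text \<open>
  Otherwise the operation S of the stage that contains \<open>W\<close> would have added a middle point of \<open>W\<close>.
\<close>

lemma meets_attached_set:
  assumes W: "W \<subseteq> mspace M" "|W| =o \<kappa>" "separated W" "hereditarily_without_middle_points \<kappa> M W"
  shows "\<exists>i x. born i x \<and> \<not> small (W \<inter> D i x)"
proof (rule ccontr)
  assume none: "\<not> ?thesis"
  obtain i where i: "i \<in> Field r" "W \<subseteq> B (s i)" using captured[OF W(1) ordIso_imp_ordLeq[OF W(2)]] by blast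
  have "small (W \<inter> insert x (D j x))" if j: "(j, i) \<in> r" "x \<in> B (s j) - B j" for j x
  proof -
    have "small (W \<inter> D j x)" using none j FieldI1 by fast
    then have "small ((W \<inter> D j x) \<union> {x})" by (rule small_Un) (simp add: small_finite)
    then show ?thesis by (rule small_subset) blast
  qed
  then have "\<exists>z\<in>S i. \<forall>y\<in>W. d z y = 1/2"
    using S_middle[OF i(1) _ W(2-4)] i(2) B_A[OF i(1)] by blast
  then obtain z where "z \<in> mspace M" "\<forall>y\<in>W. d z y = 1/2" using S_space[OF i(1)] by blast
  then show False
    using W(2,4) unfolding hereditarily_without_middle_points_def middle_point_def by blast
qed

lemma D_later_disjoint: "born i x \<Longrightarrow> born j y \<Longrightarrow> i \<in> underS r j \<Longrightarrow> D i x \<subseteq> B (s j) \<and> D i x \<inter> D j y = {}"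
  using D_A A_subset S_subset_later_B D_new by blast

text \<open>
  The younger of two attached sets hangs on one point by edges of length one.  So only this
  point of the older set can have distance one from points of the younger set.  If both sets are attached at
  the same stage, then their points even have distance more than two.
\<close>

lemma separated_meets_one_attached_set:
  assumes W: "separated W" and x: "born i x" and y: "born j y"
    and a: "a \<in> W \<inter> D i x" "a' \<in> W \<inter> D i x" "a \<noteq> a'" and b: "b \<in> W \<inter> D j y" "b' \<in> W \<inter> D j y" "b \<noteq> b'"
  shows "i = j \<and> x = y"
proof -
  have younger: False if W: "separated W" and x: "born i x" and y: "born j y" and ij: "i \<in> underS r j"
    and a: "a \<in> W \<inter> D i x" "a' \<in> W \<inter> D i x" "a \<noteq> a'" and b: "b \<in> W \<inter> D j y" for i j x y a a' b
  proof -
    have y_eq: "y = c" if c: "c \<in> W \<inter> D i x" for c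
    proof -
      have cj: "c \<in> A j - D j y" using D_later_disjoint[OF x y ij] B_A[of j] y c by blast
      then have "d b c = 1 + d y c" using D_gate y b by blast
      moreover have "d b c = 1" using bspec[OF bspec[OF W], of b c] b c cj by auto
      ultimately have "d y c = 0" by simp
      moreover have "y \<in> mspace M" "c \<in> mspace M" using y B_space[OF succ_Field] D_space[OF x] c by blast+
      ultimately show ?thesis by simp
    qed
    show False using y_eq[OF a(1)] y_eq[OF a(2)] a(3) by simp
  qed
  have ij: "i = j"
    using younger[OF W x y _ a b(1)] younger[OF W y x _ b a(1)] le_or_less[of i j] le_iff[of i j] x y by blast
  moreover have "x = y"
  proof (rule ccontr)
    assume "x \<noteq> y"
    have M: "x \<in> mspace M" "y \<in> mspace M" using x y B_space[OF succ_Field] by blast+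
    have disj: "D i x \<inter> D i y = {}" using D_disjoint x y ij \<open>x \<noteq> y\<close> by blast
    have bA: "b \<in> A i - D i x" using disj b ij D_A[of i y] y by blast
    then have "d a b = 1 + d x b" using D_gate x a by blast
    moreover have "x \<in> A i - D i y" using x y ij B_A[of i] D_new[of i y] by blast
    then have "d b x = 1 + d y x" using D_gate[of i y b x] y b ij by blast
    moreover have "d a b = 1" using bspec[OF bspec[OF W], of a b] a b bA by auto
    ultimately show False using mdist_nonneg[of M y x] mdist_commute[of M b x] by linarith
  qed
  ultimately show ?thesis by blast
qed

text \<open>
  If at least \<open>\<kappa>\<close> points of \<open>W\<close> were left outside an attached set that \<open>W\<close> meets in a large set, then they would
  meet another attached set in a large set, contrary to \<open>separated_meets_one_attached_set\<close>.
\<close>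

lemma mostly_attached_set:
  assumes W: "W \<subseteq> mspace M" "\<not> small W" "separated W" "hereditarily_without_middle_points \<kappa> M W"
  shows "\<exists>i x. born i x \<and> small (W - D i x)"
proof -
  have meets: "\<exists>i x. born i x \<and> \<not> small (V \<inter> D i x)" if V: "V \<subseteq> W" "\<not> small V" for V
  proof -
    obtain U where U: "U \<subseteq> V" "|U| =o \<kappa>" using large_subset[OF V(2)] by blast
    then obtain i x where ix: "born i x" "\<not> small (U \<inter> D i x)"
      using meets_attached_set[of U] without_middle_points_subset[OF W(4), of U] V W by blast
    moreover have "\<not> small (V \<inter> D i x)" using ix(2) small_subset[of "V \<inter> D i x" "U \<inter> D i x"] U(1) by blast
    ultimately show ?thesis by blast
  qed
  obtain i x where ix: "born i x" "\<not> small (W \<inter> D i x)" using meets[OF subset_refl W(2)] by blast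
  have "small (W - D i x)"
  proof (rule ccontr)
    assume "\<not> ?thesis"
    then obtain j y where jy: "born j y" "\<not> small ((W - D i x) \<inter> D j y)" using meets by blast
    obtain a a' where a: "a \<in> W \<inter> D i x" "a' \<in> W \<inter> D i x" "a \<noteq> a'" using large_two_points[OF ix(2)] by blast
    obtain b b' where b: "b \<in> W \<inter> D j y - D i x" "b' \<in> W \<inter> D j y - D i x" "b \<noteq> b'"
      using large_two_points[OF jy(2)] by blast
    show False
      using separated_meets_one_attached_set[OF W(3) ix(1) jy(1) a, of b b'] b by blast
  qed
  then show ?thesis using ix(1) by blast
qed

lemma card_le_if_mostly_contained:
  assumes "small (V - W)" "\<kappa> <o |V|" shows "|V| \<le>o |W|"
proof (rule ccontr)
  assume "\<not> ?thesis"
  then have "|W| <o |V|" using not_ordLeq_iff_ordLess[OF card_of_Well_order card_of_Well_order] by blast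
  moreover have "|V - W| <o |V|" using assms ordLess_transitive by blast
  moreover have "infinite V" using assms(2) greater_not_small small_finite by blast
  ultimately have "|(V - W) \<union> W| <o |V|" using card_of_Un_ordLess_infinite by blast
  moreover have "|V| \<le>o |(V - W) \<union> W|" by (rule card_of_mono1) blast
  ultimately show False using not_ordLess_ordLeq by blast
qed

text \<open>
  Across stages, the later set is larger than the space that contains the earlier one.
\<close>

lemma attached_card_inj:
  assumes x: "born i x" and y: "born j y" and eq: "|D i x| =o |D j y|"
  shows "i = j \<and> x = y"
proof -
  have False if x: "born i x" and y: "born j y" and ij: "i \<in> underS r j" and eq: "|D i x| =o |D j y|" for i j x y
  proof -
    have "|D i x| \<le>o |B (s j)|" using D_later_disjoint[OF x y ij] card_of_mono1 by blast
    then have "|D i x| <o |D j y|" using D_larger y ordLeq_ordLess_trans by blast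
    then show False using eq not_ordLess_ordIso by blast
  qed
  then have "i = j"
    using x y eq le_or_less[of i j] le_iff[of i j] ordIso_symmetric by blast
  then show ?thesis using D_inj x y eq by blast
qed

lemma isometry_image:
  assumes f: "isometry_onto M M f" and W: "W \<subseteq> mspace M" "separated W" "hereditarily_without_middle_points \<kappa> M W"
  shows "f ` W \<subseteq> mspace M" "|W| =o |f ` W|" "separated (f ` W)" "hereditarily_without_middle_points \<kappa> M (f ` W)"
proof -
  note f' = isometry_ontoD(1,2)[OF f] and inj = isometry_ontoD(3)[OF f]
  have card: "|V| =o |f ` V|" if "V \<subseteq> mspace M" for V
    using card_of_ordIsoI inj_on_imp_bij_betw[OF inj_on_subset[OF inj that]] by blast
  show "f ` W \<subseteq> mspace M" "|W| =o |f ` W|" using f'(1) W(1) card by blast+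
  show "separated (f ` W)"
  proof (intro ballI impI)
    fix u v assume "u \<in> f ` W" "v \<in> f ` W" "u \<noteq> v"
    then obtain a b where "a \<in> W" "b \<in> W" "u = f a" "v = f b" "a \<noteq> b" by blast
    then show "d u v = 1" using f'(2)[of a b] W(1,2) by auto
  qed
  show "hereditarily_without_middle_points \<kappa> M (f ` W)"
    unfolding hereditarily_without_middle_points_def
  proof
    assume "\<exists>Z\<subseteq>f ` W. |Z| =o \<kappa> \<and> (\<exists>x. middle_point M Z x)"
    then obtain Z z where Z: "Z \<subseteq> f ` W" "|Z| =o \<kappa>" "z \<in> mspace M" "\<forall>y\<in>Z. d z y = 1/2"
      unfolding middle_point_def by blast
    obtain V where V: "V \<subseteq> W" "Z = f ` V" using Z(1) by (meson subset_image_iff)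
    obtain y where y: "y \<in> mspace M" "z = f y" using Z(3) f'(1) by blast
    have "middle_point M V y"
      unfolding middle_point_def using y V W(1) Z(4) f'(2) by (metis imageI subsetD)
    moreover have "|V| =o \<kappa>" using card[of V] V W(1) Z(2) ordIso_transitive by blast
    ultimately show False using W(3) V(1) unfolding hereditarily_without_middle_points_def by blast
  qed
qed

lemma isometry_inverse:
  assumes "isometry_onto M M f"
  obtains g where "isometry_onto M M g" "\<And>x. x \<in> mspace M \<Longrightarrow> g (f x) = x"
proof -
  note f = isometry_ontoD(1,2)[OF assms] and inj = isometry_ontoD(3)[OF assms]
  define g where "g = inv_into (mspace M) f"
  have g: "g (f x) = x" if "x \<in> mspace M" for x unfolding g_def using inj that by simp
  have gM: "g y \<in> mspace M" "f (g y) = y" if "y \<in> mspace M" for y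
    using that f(1) inv_into_into[of y f "mspace M"] f_inv_into_f[of y f "mspace M"] unfolding g_def by auto
  have "g ` mspace M = g ` f ` mspace M" by (simp only: f(1))
  also have "\<dots> = mspace M" unfolding image_image by (simp cong: image_cong add: g)
  finally have "g ` mspace M = mspace M" .
  moreover have "d (g x) (g y) = d x y" if "x \<in> mspace M" "y \<in> mspace M" for x y
    using f(2)[of "g x" "g y"] gM that by simp
  ultimately have "isometry_onto M M g"
    unfolding isometry_onto_def isometric_embedding_def using gM by blast
  then show thesis using that g by blast
qed

text \<open>
  The image of \<open>D i x\<close> lies mostly in some \<open>D j y\<close>, whose image under the inverse isometry lies mostly in
  some \<open>D k z\<close>.  The latter shares two points with \<open>D i x\<close>, so it is \<open>D i x\<close>.  Hence \<open>D i x\<close> and \<open>D j y\<close>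
  have the same cardinality.
\<close>

lemma isometry_overlap:
  assumes f: "isometry_onto M M f" and x: "born i x"
  shows "small (f ` D i x - D i x)"
proof -
  obtain g where g: "isometry_onto M M g" "\<And>x. x \<in> mspace M \<Longrightarrow> g (f x) = x" using isometry_inverse[OF f] by blast
  have large: "\<not> small (D j y)" if "born j y" for j y
    using D_large that greater_not_small by blast
  have D: "\<And>j y. born j y \<Longrightarrow> D j y \<subseteq> mspace M" "\<And>j y. born j y \<Longrightarrow> separated (D j y)"
    "\<And>j y. born j y \<Longrightarrow> hereditarily_without_middle_points \<kappa> M (D j y)"
    by (erule D_space, erule conjE, erule (1) separated_D, erule conjE, erule (1) attached_without_middle_points)
  note fD = isometry_image[OF f D[OF x]]
  have "\<not> small (f ` D i x)" using large[OF x] small_le ordIso_imp_ordLeq[OF fD(2)] by blast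
  then obtain j y where y: "born j y" "small (f ` D i x - D j y)" using mostly_attached_set[OF fD(1) _ fD(3,4)] by blast
  note gD = isometry_image[OF g(1) D[OF y(1)]]
  have "\<not> small (g ` D j y)" using large[OF y(1)] small_le ordIso_imp_ordLeq[OF gD(2)] by blast
  then obtain k z where z: "born k z" "small (g ` D j y - D k z)" using mostly_attached_set[OF gD(1) _ gD(3,4)] by blast
  have ik: "k = i \<and> z = x"
  proof -
    have "\<not> small (f ` D i x \<inter> D j y)"
    proof
      assume "small (f ` D i x \<inter> D j y)"
      then have "small ((f ` D i x - D j y) \<union> (f ` D i x \<inter> D j y))" using y(2) small_Un by blast
      then show False using \<open>\<not> small (f ` D i x)\<close> by (simp add: Un_Diff_Int)
    qed
    then obtain u v where uv: "u \<in> f ` D i x \<inter> D j y" "v \<in> f ` D i x \<inter> D j y" "u \<noteq> v"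
      using large_two_points by blast
    then obtain a b where ab: "a \<in> D i x" "b \<in> D i x" "f a = u" "f b = v" "a \<noteq> b" by blast
    then have ab': "a \<in> g ` D j y \<inter> D i x" "b \<in> g ` D j y \<inter> D i x"
      using uv g(2) D(1)[OF x] by (metis IntD2 IntI imageI subsetD)+
    have "\<not> small (g ` D j y \<inter> D k z)"
    proof
      assume "small (g ` D j y \<inter> D k z)"
      then have "small ((g ` D j y - D k z) \<union> (g ` D j y \<inter> D k z))" using z(2) small_Un by blast
      then show False using \<open>\<not> small (g ` D j y)\<close> by (simp add: Un_Diff_Int)
    qed
    then obtain a' b' where "a' \<in> g ` D j y \<inter> D k z" "b' \<in> g ` D j y \<inter> D k z" "a' \<noteq> b'"
      using large_two_points by blast
    then show ?thesis using separated_meets_one_attached_set[OF gD(3) z(1) x _ _ _ ab' ab(5)] by blast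
  qed
  have "|D i x| \<le>o |D j y|"
  proof -
    have "\<kappa> <o |f ` D i x|" using D_large x fD(2) ordLess_ordIso_trans by blast
    then show ?thesis using card_le_if_mostly_contained[OF y(2)] fD(2) ordIso_ordLeq_trans by blast
  qed
  moreover have "|D j y| \<le>o |D i x|"
  proof -
    have "\<kappa> <o |g ` D j y|" using D_large y(1) gD(2) ordLess_ordIso_trans by blast
    then show ?thesis using card_le_if_mostly_contained[OF z(2)] gD(2) ik ordIso_ordLeq_trans by blast
  qed
  ultimately have "|D i x| =o |D j y|" using ordIso_iff_ordLeq by blast
  then show ?thesis using attached_card_inj[OF x y(1)] y(2) by blast
qed

text \<open>
  The point \<open>f x\<close> has distance one from the points of \<open>f ` D i x\<close>, and more than \<open>\<kappa>\<close> of these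
  lie in \<open>D i x\<close>.
\<close>

lemma isometry_near:
  assumes f: "isometry_onto M M f" and x: "born i x"
  shows "f x \<in> insert x (D i x)"
proof (rule ccontr)
  assume out: "f x \<notin> insert x (D i x)"
  note f' = isometry_ontoD(1,2)[OF f]
  have i: "i \<in> Field r" and xi: "x \<in> B (s i) - B i" using x by blast+
  have xM: "x \<in> mspace M" using xi B_space[OF succ_Field[OF i]] by blast
  have fx: "f x \<in> mspace M" using xM f'(1) by blast
  have ZM: "c \<in> mspace M" if "c \<in> insert x (D i x)" for c using that xM D_space[OF x] by blast
  have xD: "x \<in> A i - D i x" using xi B_A[OF i] D_new[OF i xi] by blast
  have dx: "d a x = 1" if "a \<in> D i x" for a
    using D_gate[OF i xi that xD] xM by simp
  have sep: "d c c' = 1" if "c \<in> insert x (D i x)" "c' \<in> insert x (D i x)" "c \<noteq> c'" for c c'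
    using that dx D_unit[OF i xi] mdist_commute[of M] by auto
  \<comment> \<open>The set \<open>D i x \<union> {x}\<close> is closed, because its points are at distance one from each other.\<close>
  have "\<exists>t. 0 < t \<and> t \<le> 1/2 \<and> (\<forall>c\<in>insert x (D i x). t \<le> d (f x) c)"
  proof (cases "\<exists>c\<in>insert x (D i x). d (f x) c < 1/2")
    case True
    then obtain c where c: "c \<in> insert x (D i x)" "d (f x) c < 1/2" by blast
    have "0 < d (f x) c" using c out fx ZM[OF c(1)] by (metis mdist_nonneg mdist_zero order_le_less)
    moreover have "d (f x) c \<le> d (f x) c'" if c': "c' \<in> insert x (D i x)" for c'
    proof (cases "c' = c")
      case False
      then have "1 \<le> d (f x) c + d (f x) c'"
        using sep[OF c(1) c'] mdist_triangle[OF ZM[OF c(1)] fx ZM[OF c']] by (simp add: mdist_commute)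
      then show ?thesis using c(2) by linarith
    qed simp
    ultimately show ?thesis using c(2) by (intro exI[of _ "d (f x) c"]) auto
  next
    case False
    then show ?thesis by (intro exI[of _ "1/2"]) force
  qed
  then obtain t where t: "0 < t" "t \<le> 1/2" "\<forall>c\<in>insert x (D i x). t \<le> d (f x) c" by blast
  have few: "|{a \<in> D i x. d (f x) a < 1 + t}| \<le>o \<kappa>"
    using few_close_points[OF i xi fx] t by blast
  have "f ` D i x \<subseteq> (f ` D i x - D i x) \<union> {a \<in> D i x. d (f x) a < 1 + t}"
  proof
    fix u assume "u \<in> f ` D i x"
    then obtain a where a: "a \<in> D i x" "u = f a" by blast
    then have "d (f x) u = 1" using f'(2)[of x a] xM ZM dx mdist_commute[of M a x] by simp
    then show "u \<in> (f ` D i x - D i x) \<union> {a \<in> D i x. d (f x) a < 1 + t}" using a t(1) by auto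
  qed
  moreover have "|(f ` D i x - D i x) \<union> {a \<in> D i x. d (f x) a < 1 + t}| \<le>o \<kappa>"
    by (rule card_of_Un_ordLeq_infinite_Field[OF inf small_imp_le[OF isometry_overlap[OF f x]] few Card])
  ultimately have "|f ` D i x| \<le>o \<kappa>" using le_subset by blast
  moreover have "\<kappa> <o |f ` D i x|"
    using D_large[OF i xi] isometry_image(2)[OF f D_space[OF x] separated_D[OF i xi]
        attached_without_middle_points[OF i xi]] ordLess_ordIso_trans by blast
  ultimately show False using greater_not_le by blast
qed

text \<open>
  A point of \<open>D i x\<close> is born after \<open>x\<close>, so \<open>f x \<in> D i x\<close> and \<open>x \<in> D j (f x)\<close> exclude each other.
\<close>

lemma rigid: "rigid M"
  unfolding rigid_def
proof (intro allI impI ballI)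
  fix f x assume f: "isometry_onto M M f" and xM: "x \<in> mspace M"
  obtain i where x: "born i x" using birth[OF xM] by blast
  show "f x = x"
  proof (rule ccontr)
    assume ne: "f x \<noteq> x"
    then have fx: "f x \<in> D i x" using isometry_near[OF f x] by blast
    then have fxM: "f x \<in> mspace M" using D_space[OF x] by blast
    obtain j where y: "born j (f x)" using birth[OF fxM] by blast
    obtain g where g: "isometry_onto M M g" "\<And>x. x \<in> mspace M \<Longrightarrow> g (f x) = x" using isometry_inverse[OF f] by blast
    have "x \<in> D j (f x)" using isometry_near[OF g(1) y] g(2)[OF xM] ne by auto
    then have "x \<notin> B (s j)" using D_new y by blast
    moreover have "f x \<notin> B (s i)" using D_new x fx by blast
    moreover have "(i, j) \<in> r \<or> (j, i) \<in> r" using le_or_less[of i j] underS_Field_r x y by blast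
    ultimately show False using x y B_mono[OF succ_mono, of i j] B_mono[OF succ_mono, of j i] by blast
  qed
qed

end


section \<open>Superuniversality\<close>

context tower
begin

lemma one_point_extension:
  assumes E: "E \<subseteq> mspace M" "small E" and pos: "\<forall>q\<in>E. 0 < e q"
    and kat: "\<forall>q\<in>E. \<forall>q'\<in>E. e q \<le> d q q' + e q' \<and> d q q' \<le> e q + e q'"
  shows "\<exists>p\<in>mspace M. \<forall>q\<in>E. d p q = e q"
proof (cases "E = {}")
  case True
  then show ?thesis using stage_one B_space[OF succ_Field[OF zero_Field]] by blast
next
  case False
  obtain i where i: "i \<in> Field r" "E \<subseteq> B (s i)" using captured[OF E(1) small_imp_le[OF E(2)]] by blast
  then have "E \<subseteq> S i" using B_A A_subset by blast
  from F_realizes[OF i(1) this E(2) False pos kat]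
  show ?thesis using B_space[OF succ_Field[OF succ_Field[OF i(1)]]] by blast
qed

text \<open>
  The points of \<open>Y\<close> outside \<open>Z\<close> are mapped one by one along a well-order in which each of them has fewer than
  \<open>\<kappa>\<close> predecessors.
\<close>

lemma superuniversal: "superuniversal TYPE('b) \<kappa> M"
  unfolding superuniversal_def
proof (intro allI impI, elim conjE)
  fix Y :: "'b metric" and Z f
  assume Y: "|mspace Y| \<le>o \<kappa>" and Z: "Z \<subseteq> mspace Y" "small Z" and f: "isometric_embedding (submetric Y Z) M f"
  have fM: "f z \<in> mspace M" if "z \<in> Z" for z
    using f that Z(1) unfolding isometric_embedding_def by auto
  have fd: "d (f a) (f b) = mdist Y a b" if "a \<in> Z" "b \<in> Z" for a b
    using f that Z(1) unfolding isometric_embedding_def by auto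
  define R where "R = |mspace Y - Z|"
  have WO_R: "Well_order R" unfolding R_def by (rule card_of_Well_order)
  have Field_R: "Field R = mspace Y - Z" unfolding R_def by (rule Field_card_of)
  have less: "(b, a) \<in> R - Id \<longleftrightarrow> b \<in> underS R a" for a b unfolding underS_def by blast
  have R_dom: "b \<in> mspace Y - Z \<and> a \<in> mspace Y - Z" if "b \<in> underS R a" for a b
    using that unfolding Field_R[symmetric] underS_def Field_def by auto
  have total: "a = b \<or> b \<in> underS R a \<or> a \<in> underS R b" if "a \<in> mspace Y - Z" "b \<in> mspace Y - Z" for a b
    using Well_order_total[OF WO_R] that unfolding Field_R total_on_def underS_def by blast
  have small_below: "small (underS R y)" if "y \<in> mspace Y - Z" for y
  proof -
    have "|underS R y| <o R"
      unfolding R_def by (rule card_of_underS[OF card_of_Card_order]) (simp only: Field_card_of that)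
    moreover have "R \<le>o |mspace Y|" unfolding R_def by (rule card_of_mono1) blast
    ultimately show ?thesis by (rule ordLess_ordLeq_trans[OF _ ordLeq_transitive[OF _ Y]])
  qed
  define P where "P g y p \<longleftrightarrow> (y \<in> mspace Y - Z \<longrightarrow> p \<in> mspace M \<and> (\<forall>q\<in>Z. d p (f q) = mdist Y y q) \<and>
      (\<forall>q\<in>underS R y. d p (g q) = mdist Y y q))" for g y p
  have "\<exists>g. \<forall>y. P g y (g y)"
  proof (rule dependent_wf_choice[OF Well_order_wf[OF WO_R]])
    fix g g' :: "'b \<Rightarrow> 'a" and y p assume "\<And>z. (z, y) \<in> R - Id \<Longrightarrow> g z = g' z"
    then have "\<forall>z\<in>underS R y. g z = g' z" unfolding less by blast
    then show "P g y p = P g' y p" unfolding P_def by auto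
  next
    fix y and g :: "'b \<Rightarrow> 'a" assume "\<And>z. (z, y) \<in> R - Id \<Longrightarrow> P g z (g z)"
    then have IH: "P g z (g z)" if "z \<in> underS R y" for z using that unfolding less by blast
    show "\<exists>p. P g y p"
    proof (cases "y \<in> mspace Y - Z")
      case False
      then show ?thesis unfolding P_def by blast
    next
      case True
      define W where "W = Z \<union> underS R y"
      define h where "h q = (if q \<in> Z then f q else g q)" for q
      have W: "q \<in> mspace Y" "q \<noteq> y" if "q \<in> W" for q
        using that R_dom[of q y] Z(1) True unfolding W_def underS_def by auto
      have hM: "h q \<in> mspace M" if "q \<in> W" for q
        using that fM IH[of q] R_dom[of q y] unfolding W_def h_def P_def by auto
      have hd: "d (h a) (h b) = mdist Y a b" if a: "a \<in> W" and b: "b \<in> W" for a b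
      proof -
        have old: "d (h a) (h b) = mdist Y a b" if ab: "a \<in> underS R y" "b \<in> Z \<or> b \<in> underS R a" for a b
          using IH[OF ab(1)] R_dom[OF ab(1)] R_dom[of b a] ab(2) unfolding P_def h_def by auto
        consider "a \<in> Z" "b \<in> Z" | "a \<in> underS R y" "b \<in> Z \<or> b \<in> underS R a"
          | "b \<in> underS R y" "a \<in> Z \<or> a \<in> underS R b" | "a = b"
          using a b total[of a b] R_dom[of a y] R_dom[of b y] unfolding W_def by blast
        then show ?thesis
        proof cases
          case 1
          then show ?thesis using fd unfolding h_def by simp
        next
          case 2
          then show ?thesis by (rule old)
        next
          case 3
          then show ?thesis using old[of b a] by (simp add: mdist_commute)
        next
          case 4
          then show ?thesis using hM[OF a] W(1)[OF a] by simp
        qed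
      qed
      have inj: "inj_on h W"
      proof (rule inj_onI)
        fix a b assume "a \<in> W" "b \<in> W" "h a = h b"
        then show "a = b" using hd[of a b] hM[of b] W(1)[of a] W(1)[of b] by auto
      qed
      define e where "e p = mdist Y y (inv_into W h p)" for p
      have e: "e (h a) = mdist Y y a" if "a \<in> W" for a unfolding e_def using inj that by simp
      have "\<exists>p\<in>mspace M. \<forall>q\<in>h ` W. d p q = e q"
      proof (rule one_point_extension)
        show "h ` W \<subseteq> mspace M" using hM by blast
        show "small (h ` W)" unfolding W_def by (intro small_image small_Un Z(2) small_below True)
        show "\<forall>q\<in>h ` W. 0 < e q"
        proof
          fix q assume "q \<in> h ` W"
          then obtain a where a: "a \<in> W" "q = h a" by blast
          have "mdist Y y a \<noteq> 0" using W[OF a(1)] True by simp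
          then show "0 < e q" using e[OF a(1)] a(2) mdist_nonneg[of Y y a] by (simp add: less_le)
        qed
        show "\<forall>q\<in>h ` W. \<forall>q'\<in>h ` W. e q \<le> d q q' + e q' \<and> d q q' \<le> e q + e q'"
        proof (intro ballI)
          fix q q' assume "q \<in> h ` W" "q' \<in> h ` W"
          then obtain a b where ab: "a \<in> W" "q = h a" "b \<in> W" "q' = h b" by blast
          have M: "y \<in> mspace Y" "a \<in> mspace Y" "b \<in> mspace Y" using True W(1) ab by blast+
          show "e q \<le> d q q' + e q' \<and> d q q' \<le> e q + e q'"
            using mdist_triangle[OF M(1) M(3) M(2)] mdist_triangle[OF M(2) M(1) M(3)] e[OF ab(1)] e[OF ab(3)]
              hd[OF ab(1,3)] ab(2,4) by (simp add: mdist_commute)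
        qed
      qed
      then obtain p where p: "p \<in> mspace M" "\<forall>a\<in>W. d p (h a) = mdist Y y a" using e by auto
      have "d p (f q) = mdist Y y q" if "q \<in> Z" for q
        using bspec[OF p(2), of q] that unfolding W_def h_def by auto
      moreover have "d p (g q) = mdist Y y q" if "q \<in> underS R y" for q
        using bspec[OF p(2), of q] that R_dom[OF that] unfolding W_def h_def by auto
      ultimately show ?thesis unfolding P_def using p(1) by blast
    qed
  qed
  then obtain g where g: "\<And>y. P g y (g y)" by blast
  define h where "h q = (if q \<in> Z then f q else g q)" for q
  have hM: "h q \<in> mspace M" if "q \<in> mspace Y" for q
    using that fM g[of q] unfolding h_def P_def by auto
  have "d (h a) (h b) = mdist Y a b" if a: "a \<in> mspace Y" and b: "b \<in> mspace Y" for a b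
  proof -
    have new: "d (h a) (h b) = mdist Y a b" if ab: "a \<in> mspace Y - Z" "b \<in> Z \<or> b \<in> underS R a" for a b
      using g[of a] ab R_dom[of b a] unfolding P_def h_def by auto
    consider "a \<in> Z" "b \<in> Z" | "a \<in> mspace Y - Z" "b \<in> Z \<or> b \<in> underS R a"
      | "b \<in> mspace Y - Z" "a \<in> Z \<or> a \<in> underS R b" | "a = b"
      using a b total[of a b] by blast
    then show ?thesis
    proof cases
      case 1
      then show ?thesis using fd unfolding h_def by simp
    next
      case 2
      then show ?thesis by (rule new)
    next
      case 3
      then show ?thesis using new[of b a] by (simp add: mdist_commute)
    next
      case 4
      then show ?thesis using hM a by simp
    qed
  qed
  then have "isometric_embedding Y M h" unfolding isometric_embedding_def using hM by blast
  moreover have "\<forall>z\<in>Z. h z = f z" unfolding h_def by simp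
  ultimately show "\<exists>g. isometric_embedding Y M g \<and> (\<forall>z\<in>Z. g z = f z)" by blast
qed

end


section \<open>The construction yields a tower\<close>

lemma subspace_mdist: "is_subspace M N \<Longrightarrow> x \<in> mspace M \<Longrightarrow> y \<in> mspace M \<Longrightarrow> mdist M x y = mdist N x y"
  unfolding is_subspace_def agree_on_def by blast

lemma is_subspace_trans: "is_subspace K M \<Longrightarrow> is_subspace M N \<Longrightarrow> is_subspace K N"
  unfolding is_subspace_def agree_on_def by (metis order_trans subsetD)

lemma is_subspace_subset: "is_subspace K M \<Longrightarrow> mspace K \<subseteq> mspace M"
  unfolding is_subspace_def by blast

text \<open>
  A middle point in a subspace is a middle point in the whole space.  So a separated set
  without middle points in the union is without middle points in each stage that contains it.
\<close>

lemma mem_discrete_without_middle_points: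
  fixes A M :: "'a metric"
  assumes sub: "is_subspace A M"
  shows "Y \<in> discrete_without_middle_points \<kappa> A \<Longrightarrow>
      Y \<subseteq> mspace A \<and> |Y| =o \<kappa> \<and> (\<forall>y\<in>Y. \<forall>y'\<in>Y. y \<noteq> y' \<longrightarrow> mdist M y y' = 1)"
    and "Y \<subseteq> mspace A \<Longrightarrow> |Y| =o \<kappa> \<Longrightarrow> \<forall>y\<in>Y. \<forall>y'\<in>Y. y \<noteq> y' \<longrightarrow> mdist M y y' = 1 \<Longrightarrow>
      hereditarily_without_middle_points \<kappa> M Y \<Longrightarrow> Y \<in> discrete_without_middle_points \<kappa> A"
proof -
  assume Y: "Y \<in> discrete_without_middle_points \<kappa> A"
  then have *: "Y \<subseteq> mspace A" "|Y| =o \<kappa>" "is_discrete (submetric A Y)"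
    unfolding discrete_without_middle_points_def by auto
  have "mdist M y y' = 1" if y: "y \<in> Y" "y' \<in> Y" "y \<noteq> y'" for y y'
  proof -
    have m: "y \<in> mspace A" "y' \<in> mspace A" using *(1) y by auto
    have "mdist A y y' \<in> {0, 1}" using *(3)[unfolded is_discrete_def, rule_format, of y y'] y m by simp
    moreover have "mdist A y y' \<noteq> 0" using m y(3) by simp
    ultimately show ?thesis using subspace_mdist[OF sub m] by auto
  qed
  with * show "Y \<subseteq> mspace A \<and> |Y| =o \<kappa> \<and> (\<forall>y\<in>Y. \<forall>y'\<in>Y. y \<noteq> y' \<longrightarrow> mdist M y y' = 1)" by blast
next
  assume Y: "Y \<subseteq> mspace A" "|Y| =o \<kappa>" "\<forall>y\<in>Y. \<forall>y'\<in>Y. y \<noteq> y' \<longrightarrow> mdist M y y' = 1"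
    and none: "hereditarily_without_middle_points \<kappa> M Y"
  have "is_discrete (submetric A Y)"
    unfolding is_discrete_def
  proof (intro ballI)
    fix y y' assume "y \<in> mspace (submetric A Y)" "y' \<in> mspace (submetric A Y)"
    then have y: "y \<in> Y" "y' \<in> Y" "y \<in> mspace A" "y' \<in> mspace A" by auto
    show "mdist (submetric A Y) y y' \<in> {0, 1}"
      using bspec[OF bspec[OF Y(3) y(1)] y(2)] subspace_mdist[OF sub y(3,4)] y(3) by (cases "y = y'") auto
  qed
  moreover have "hereditarily_without_middle_points \<kappa> A Y"
    unfolding hereditarily_without_middle_points_def
  proof
    assume "\<exists>Z. Z \<subseteq> Y \<and> |Z| =o \<kappa> \<and> (\<exists>x. middle_point A Z x)"
    then obtain Z x where Z: "Z \<subseteq> Y" "|Z| =o \<kappa>" "middle_point A Z x" by blast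
    then have x: "x \<in> mspace A" "\<forall>y\<in>Z. mdist A x y = 1/2" unfolding middle_point_def by auto
    have "mdist M x y = 1/2" if "y \<in> Z" for y
      using subspace_mdist[OF sub x(1), of y] x(2) that Z(1) Y(1) by auto
    then have "middle_point M Z x"
      using x(1) is_subspace_subset[OF sub] unfolding middle_point_def by blast
    then show False using none Z(1,2) unfolding hereditarily_without_middle_points_def by blast
  qed
  ultimately show "Y \<in> discrete_without_middle_points \<kappa> A"
    using Y(1,2) unfolding discrete_without_middle_points_def by blast
qed

lemma infinite_Field_if_continuum_less:
  assumes "continuum <o \<kappa>" shows "infinite (Field \<kappa>)"
proof -
  have "natLeq <o continuum" by (rule ordLess_ctwo_cexp[OF natLeq_Card_order])
  then have "natLeq \<le>o \<kappa>" using assms ordLess_transitive ordLess_imp_ordLeq by blast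
  then show ?thesis using cinfinite_mono[of natLeq \<kappa>] natLeq_cinfinite unfolding cinfinite_def by blast
qed

text \<open>
  All spaces of the construction are subspaces of the union, so the distances in the descriptions
  of the three operations can be replaced by those of the union.
\<close>

lemma construction_tower:
  fixes \<kappa> :: "'k rel" and X :: "'k set \<Rightarrow> 'a metric" and \<A> :: "'k set \<Rightarrow> 'a set set" and M :: "'a metric"
  assumes \<kappa>: "Card_order \<kappa>" "regularCard \<kappa>" "infinite (Field \<kappa>)" and constr: "is_construction \<kappa> X \<A> M"
  obtains A S D where "tower \<kappa> M (\<lambda>i. mspace (X i)) A S D"
proof -
  let ?r = "cardSuc \<kappa>" and ?s = "ord_succ (cardSuc \<kappa>)"
  have zero: "mspace (X (ord_zero ?r)) = {}"
    and one: "\<exists>p. mspace (X (?s (ord_zero ?r))) = {p}"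
    and lim: "\<forall>\<alpha>. ord_limit ?r \<alpha> \<longrightarrow>
            mspace (X \<alpha>) = (\<Union>\<beta>\<in>underS ?r \<alpha>. mspace (X \<beta>)) \<and>
            (\<forall>\<beta>\<in>underS ?r \<alpha>. is_subspace (X \<beta>) (X \<alpha>)) \<and>
            mspace (X (?s \<alpha>)) = mspace (X \<alpha>) \<and> is_subspace (X \<alpha>) (X (?s \<alpha>)) \<and>
            \<A> \<alpha> = {}"
    and step: "\<forall>\<beta>\<in>Field ?r. \<exists>AX SX.
            is_A \<kappa> (X (?s \<beta>)) (mspace (X \<beta>)) AX (\<A> \<beta>) \<and>
            is_S \<kappa> AX (\<Union>\<gamma>\<in>under ?r \<beta>. \<A> \<gamma>) SX \<and>
            is_F \<kappa> SX (X (?s (?s \<beta>)))"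
    and union: "mspace M = (\<Union>\<alpha>\<in>Field ?r. mspace (X \<alpha>))"
    and sub: "\<forall>\<alpha>\<in>Field ?r. is_subspace (X \<alpha>) M"
    using constr unfolding is_construction_def Let_def by - (elim conjE, assumption)+
  interpret regular_cardinal \<kappa> by (rule regular_cardinal.intro) (rule \<kappa>)+
  interpret limit_order ?r
    by (rule limit_order.intro) (use \<kappa> cardSuc_Card_order cardSuc_finite in blast)+
  obtain AX SX where
    isA: "\<And>i. i \<in> Field ?r \<Longrightarrow> is_A \<kappa> (X (s i)) (mspace (X i)) (AX i) (\<A> i)"
    and isS: "\<And>i. i \<in> Field ?r \<Longrightarrow> is_S \<kappa> (AX i) (\<Union>j\<in>under ?r i. \<A> j) (SX i)"
    and isF: "\<And>i. i \<in> Field ?r \<Longrightarrow> is_F \<kappa> (SX i) (X (s (s i)))"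
    using step by metis
  define Q where "Q i D \<longleftrightarrow> is_subspace (X (s i)) (AX i) \<and>
    mspace (AX i) = mspace (X (s i)) \<union> (\<Union>x\<in>mspace (X (s i)) - mspace (X i). D x) \<and>
    \<A> i = (\<lambda>x. insert x (D x)) ` (mspace (X (s i)) - mspace (X i)) \<and>
    (\<forall>x\<in>mspace (X (s i)) - mspace (X i). D x \<inter> mspace (X (s i)) = {} \<and>
      (\<forall>a\<in>D x. \<forall>b\<in>D x. a \<noteq> b \<longrightarrow> mdist (AX i) a b = 1) \<and>
      (\<forall>a\<in>D x. \<forall>b\<in>mspace (AX i) - D x. mdist (AX i) a b = 1 + mdist (AX i) x b) \<and>
      \<kappa> <o |D x| \<and> |mspace (X (s i))| <o |D x| \<and>
      (\<forall>y\<in>mspace (X (s i)) - mspace (X i). (x \<noteq> y \<longrightarrow> D x \<inter> D y = {}) \<and> ( |D x| =o |D y| \<longrightarrow> x = y)))" for i D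
  have "\<forall>i. i \<in> Field ?r \<longrightarrow> (\<exists>D. Q i D)"
  proof (intro allI impI)
    fix i assume "i \<in> Field ?r"
    from attached_set_structure[OF isA[OF this] \<kappa>(1)] obtain D where "Q i D"
      unfolding Q_def by (smt (verit, best))
    then show "\<exists>D. Q i D" by blast
  qed
  then obtain D where Q: "\<And>i. i \<in> Field ?r \<Longrightarrow> Q i (D i)" by metis
  note Qx = bspec[OF conjunct2[OF conjunct2[OF conjunct2[OF Q[unfolded Q_def]]]]]
  have A_eq: "mspace (AX i) = mspace (X (s i)) \<union> (\<Union>x\<in>mspace (X (s i)) - mspace (X i). D i x)" if "i \<in> Field ?r" for i
    using Q[OF that] unfolding Q_def by (elim conjE)
  have DA: "a \<in> mspace (AX i)" if "i \<in> Field ?r" "x \<in> mspace (X (s i)) - mspace (X i)" "a \<in> insert x (D i x)" for i x a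
    unfolding A_eq[OF that(1)] using that(2,3) by blast
  have subB: "is_subspace (X i) M" if "i \<in> Field ?r" for i using sub that by blast
  have AS: "mspace (AX i) \<subseteq> mspace (SX i)" if "i \<in> Field ?r" for i
    by (rule is_subspace_subset[OF middle_point_extension_structure(1)[OF isS[OF that]]])
  have SB: "mspace (SX i) \<subseteq> mspace (X (s (s i)))" if "i \<in> Field ?r" for i
    by (rule is_subspace_subset[OF one_point_extension_structure(1)[OF isF[OF that]]])
  have subS: "is_subspace (SX i) M" if "i \<in> Field ?r" for i
    using is_subspace_trans[OF one_point_extension_structure(1)[OF isF[OF that]]] subB succ_Field that by blast
  have subA: "is_subspace (AX i) M" if "i \<in> Field ?r" for i
    using is_subspace_trans[OF middle_point_extension_structure(1)[OF isS[OF that]] subS[OF that]] .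
  have small_iff: "(\<forall>Z\<in>(\<Union>j\<in>under ?r i. \<A> j). small (Y \<inter> Z)) \<longleftrightarrow>
      (\<forall>j x. (j, i) \<in> ?r \<longrightarrow> x \<in> mspace (X (s j)) - mspace (X j) \<longrightarrow> small (Y \<inter> insert x (D j x)))" for i Y
  proof -
    have "\<A> j = (\<lambda>x. insert x (D j x)) ` (mspace (X (s j)) - mspace (X j))" if "(j, i) \<in> ?r" for j
      using Q[OF FieldI1[OF that]] unfolding Q_def by blast
    then show ?thesis unfolding under_def by fastforce
  qed
  have "tower \<kappa> M (\<lambda>i. mspace (X i)) (\<lambda>i. mspace (AX i)) (\<lambda>i. mspace (SX i)) D"
  proof (unfold_locales, goal_cases)
    case 1 then show ?case by (rule zero)
  next
    case 2 then show ?case using one by auto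
  next
    case (3 i) then show ?case using lim by blast
  next
    case (4 i) then show ?case using lim by blast
  next
    case 5 then show ?case by (rule union)
  next
    case (6 i) then show ?case by (rule SB)
  next
    case (7 i) then show ?case by (rule AS)
  next
    case (8 i) then show ?case by (rule A_eq)
  next
    case (9 i x) then show ?case using Qx[OF 9(1,2)] by (elim conjE)
  next
    case (10 i x a b)
    have "mdist (AX i) a b = 1" using Qx[OF 10(1,2)] 10(3-5) by blast
    then show ?case using subspace_mdist[OF subA[OF 10(1)], of a b] DA[OF 10(1,2)] 10(3,4) by simp
  next
    case (11 i x a b)
    have "mdist (AX i) a b = 1 + mdist (AX i) x b" using Qx[OF 11(1,2)] 11(3,4) by blast
    then show ?case
      using subspace_mdist[OF subA[OF 11(1)], of a b] subspace_mdist[OF subA[OF 11(1)], of x b]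
        DA[OF 11(1,2)] 11(3,4) by simp
  next
    case (12 i x) then show ?case using Qx[OF 12(1,2)] by (elim conjE)
  next
    case (13 i x) then show ?case using Qx[OF 13(1,2)] by (elim conjE)
  next
    case (14 i x y) then show ?case using Qx[OF 14(1,2)] by blast
  next
    case (15 i x y) then show ?case using Qx[OF 15(1,2)] by blast
  next
    case (16 i z)
    obtain Y where Y: "Y \<in> discrete_without_middle_points \<kappa> (AX i)"
      "\<forall>Z\<in>(\<Union>j\<in>under ?r i. \<A> j). small (Y \<inter> Z)"
      "\<forall>b\<in>mspace (SX i) - {z}. \<forall>\<epsilon>>0. \<exists>y\<in>Y. 1/2 + mdist (SX i) y b < mdist (SX i) z b + \<epsilon>"
      using middle_point_extension_structure(2)[OF isS[OF 16(1)] 16(2)] by blast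
    note mem = mem_discrete_without_middle_points(1)[OF subA[OF 16(1)] Y(1)]
    from AS[OF 16(1)] have YS: "y \<in> mspace (SX i)" if "y \<in> Y" for y using mem that by blast
    have "\<exists>y\<in>Y. 1/2 + mdist M y b < mdist M z b + \<epsilon>" if b: "b \<in> mspace (SX i) - {z}" and \<epsilon>: "\<epsilon> > 0" for b and \<epsilon> :: real
    proof -
      obtain y where y: "y \<in> Y" "1/2 + mdist (SX i) y b < mdist (SX i) z b + \<epsilon>" using Y(3) b \<epsilon> by blast
      then have "1/2 + mdist M y b < mdist M z b + \<epsilon>"
        using subspace_mdist[OF subS[OF 16(1)]] YS[OF y(1)] b 16(2) by simp
      then show ?thesis using y(1) by blast
    qed
    then show ?case using mem Y(2) unfolding small_iff by blast
  next
    case (17 i Y)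
    have "Y \<in> discrete_without_middle_points \<kappa> (AX i)"
      by (rule mem_discrete_without_middle_points(2)[OF subA[OF 17(1)] 17(2-5)])
    then obtain z where z: "z \<in> mspace (SX i)" "\<forall>y\<in>Y. mdist (SX i) z y = 1/2"
      using middle_point_extension_structure(3)[OF isS[OF 17(1)]] 17(6) unfolding small_iff by blast
    from AS[OF 17(1)] have "mdist M z y = 1/2" if "y \<in> Y" for y
      using subspace_mdist[OF subS[OF 17(1)] z(1), of y] z(2) that 17(2) by auto
    then show ?case using z(1) by blast
  next
    case (18 i p)
    obtain E where E: "E \<subseteq> mspace (SX i)" "small E"
      "\<forall>b\<in>mspace (SX i). \<forall>\<epsilon>>0. \<exists>q\<in>E. mdist (X (s (s i))) p q + mdist (X (s (s i))) q b < mdist (X (s (s i))) p b + \<epsilon>"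
      using one_point_extension_structure(2)[OF isF[OF 18(1)] 18(2)] by blast
    from SB[OF 18(1)] have eq: "mdist (X (s (s i))) u v = mdist M u v"
      if "u = p \<or> u \<in> mspace (SX i)" "v \<in> mspace (SX i)" for u v
      using subspace_mdist[OF subB[OF succ_Field[OF succ_Field[OF 18(1)]]], of u v] that 18(2) by blast
    have "\<exists>q\<in>E. mdist M p q + mdist M q b < mdist M p b + \<epsilon>" if b: "b \<in> mspace (SX i)" and \<epsilon>: "\<epsilon> > 0" for b and \<epsilon> :: real
    proof -
      obtain q where q: "q \<in> E" "mdist (X (s (s i))) p q + mdist (X (s (s i))) q b < mdist (X (s (s i))) p b + \<epsilon>"
        using E(3) b \<epsilon> by blast
      have qS: "q \<in> mspace (SX i)" using q(1) E(1) by blast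
      then show ?thesis using q eq[of p q] eq[of q b] eq[of p b] b by (intro bexI[OF _ q(1)]) simp
    qed
    then show ?case using E(1,2) by blast
  next
    case (19 i E e)
    have eq: "mdist (SX i) u v = mdist M u v" if "u \<in> E" "v \<in> E" for u v
      using subspace_mdist[OF subS[OF 19(1)], of u v] that 19(2) by blast
    obtain p where p: "p \<in> mspace (X (s (s i)))" "\<forall>q\<in>E. mdist (X (s (s i))) p q = e q"
      using one_point_extension_structure(3)[OF isF[OF 19(1)] 19(2-5)] 19(6) eq by auto
    from SB[OF 19(1)] have "mdist M p q = e q" if "q \<in> E" for q
      using subspace_mdist[OF subB[OF succ_Field[OF succ_Field[OF 19(1)]]] p(1), of q] p(2) that 19(2) by auto
    then show ?case using p(1) by blast
  qed
  then show thesis by (rule that)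
qed


theorem theorem6p13:
  fixes \<kappa> :: "'k rel"
    and X :: "'k set \<Rightarrow> 'a metric"
    and \<A> :: "'k set \<Rightarrow> 'a set set"
    and X\<kappa> :: "'a metric"
  assumes "Card_order \<kappa>" and "regularCard \<kappa>" and "continuum <o \<kappa>"
    and "\<forall>\<mu> :: 'k rel. Card_order \<mu> \<and> \<mu> <o \<kappa> \<longrightarrow> \<mu> ^c natLeq <o \<kappa>"
    and "is_construction \<kappa> X \<A> X\<kappa>"
  shows "rigid X\<kappa> \<and> superuniversal TYPE('b) \<kappa> X\<kappa>"
proof -
  obtain A S D where "tower \<kappa> X\<kappa> (\<lambda>i. mspace (X i)) A S D"
    using construction_tower[OF assms(1,2) infinite_Field_if_continuum_less[OF assms(3)] assms(5)] .
  then interpret tower \<kappa> X\<kappa> "\<lambda>i. mspace (X i)" A S D .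
  show ?thesis using rigid superuniversal by blast
qed

end
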